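(* Let $n=2^e\ge 4$, and let $k,l,k_1,l_1\in\{0,1\}$, all equal to $0$ if $e=2$. Let $a,b$ be the defining generators of $G_2(e;k,l)$ and let $a_1,b_1$ be the corresponding defining generators of $G_2(e;k_1,l_1)$. Each isomorphism $\sigma\colon G_2(e;k_1,l_1)\to G_2(e;k,l)$ is given by setting $a_1^\sigma=a^ib^j$ and $b_1^\sigma=a^fb^h$, where $i,j,f,h$ are integers such that (i) $k_1\equiv k+\frac{l(f+h-i-j)}{2}\pmod 2$, (ii) $l_1=l$, and (iii) either $i$ and $h$ are odd and $j$ and $f$ are even, or $i$ and $h$ are even and $j$ and $f$ are odd. Moreover, each choice of the parameters $i,j,f,h$ satisfying these conditions determines an isomorphism $G_2(e;k_1,l_1)\to G_2(e;k,l)$.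
   Context: Conventions: $x^y=y^{-1}xy$ and $[x,y]=x^{-1}y^{-1}xy$; $g^\sigma$ denotes the image of $g$ under $\sigma$. For $n=2^e\ge 4$ and $k,l\in\{0,1\}$ (with $k=l=0$ when $n=4$), $$G_2(e;k,l)=\langle a,b\mid a^n=b^n=[b^2,a^2]=1,\ [b,a]=a^2b^{-2}(a^{n/2}b^{n/2})^k,\ (b^2)^a=b^{-2}(a^{n/2}b^{n/2})^l,\ (a^2)^b=a^{-2}(a^{n/2}b^{n/2})^l\rangle .$$ $G_2(e;k_1,l_1)$ is the group with the same presentation with $a,b,k,l$ replaced by $a_1,b_1,k_1,l_1$. *)

theory Defs
  imports "HOL-Algebra.Group" "HOL-Number_Theory.Cong"
begin

section \<open>Groups given by a presentation\<close>

text \<open>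
  A word is a list of signed generators: \<open>(g, True)\<close> stands for \<open>g\<close> and \<open>(g, False)\<close> for its inverse.
  The group presented by generators \<open>'g\<close> and a set \<open>R\<close> of relations \<open>u = v\<close> consists of the words
  modulo the least congruence that contains \<open>R\<close> and allows free cancellation.
\<close>

type_synonym 'g word = "('g \<times> bool) list"

definition word_gen :: "'g \<Rightarrow> 'g word" where
  "word_gen g = [(g, True)]"

definition word_inv :: "'g word \<Rightarrow> 'g word" where
  "word_inv w = map (\<lambda>(g, s). (g, \<not> s)) (rev w)"

definition word_pow :: "'g word \<Rightarrow> nat \<Rightarrow> 'g word" where
  "word_pow w n = concat (replicate n w)"

definition word_conj :: "'g word \<Rightarrow> 'g word \<Rightarrow> 'g word" where
  "word_conj x y = word_inv y @ x @ y"

definition word_comm :: "'g word \<Rightarrow> 'g word \<Rightarrow> 'g word" where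
  "word_comm x y = word_inv x @ word_inv y @ x @ y"

inductive pres_eq :: "('g word \<times> 'g word) set \<Rightarrow> 'g word \<Rightarrow> 'g word \<Rightarrow> bool" for R where
  refl: "pres_eq R u u"
| sym: "pres_eq R u v \<Longrightarrow> pres_eq R v u"
| trans: "pres_eq R u v \<Longrightarrow> pres_eq R v w \<Longrightarrow> pres_eq R u w"
| append: "pres_eq R u u' \<Longrightarrow> pres_eq R v v' \<Longrightarrow> pres_eq R (u @ v) (u' @ v')"
| cancel: "pres_eq R [(g, s), (g, \<not> s)] []"
| relation: "(u, v) \<in> R \<Longrightarrow> pres_eq R u v"

definition word_class :: "('g word \<times> 'g word) set \<Rightarrow> 'g word \<Rightarrow> 'g word set" where
  "word_class R w = {v. pres_eq R w v}"

definition presented_group :: "('g word \<times> 'g word) set \<Rightarrow> 'g word set monoid" where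
  "presented_group R =
    \<lparr>carrier = range (word_class R),
     monoid.mult = (\<lambda>A B. \<Union>u\<in>A. \<Union>v\<in>B. word_class R (u @ v)),
     one = word_class R []\<rparr>"

lemma word_class_eq_iff: "word_class R u = word_class R v \<longleftrightarrow> pres_eq R u v"
  unfolding word_class_def by (blast intro: pres_eq.refl pres_eq.sym pres_eq.trans)

lemma presented_group_mult:
  "word_class R u \<otimes>\<^bsub>presented_group R\<^esub> word_class R v = word_class R (u @ v)"
proof -
  have *: "word_class R (u' @ v') = word_class R (u @ v)"
    if "u' \<in> word_class R u" "v' \<in> word_class R v" for u' v'
  proof -
    have "pres_eq R u u'" "pres_eq R v v'"
      using that by (simp_all add: word_class_def)
    hence "pres_eq R (u @ v) (u' @ v')"
      by (rule pres_eq.append)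
    thus ?thesis
      unfolding word_class_eq_iff by (rule pres_eq.sym)
  qed
  have u: "u \<in> word_class R u" and v: "v \<in> word_class R v"
    by (simp_all add: word_class_def pres_eq.refl)
  have "(\<Union>u'\<in>word_class R u. \<Union>v'\<in>word_class R v. word_class R (u' @ v')) = word_class R (u @ v)"
    using * u v by blast
  thus ?thesis
    by (simp add: presented_group_def)
qed

lemma pres_eq_word_inv: "pres_eq R (word_inv w @ w) []"
proof (induction w)
  case Nil
  show ?case by (simp add: word_inv_def pres_eq.refl)
next
  case (Cons x w)
  obtain g s where x: "x = (g, s)" by (cases x)
  have "pres_eq R [(g, \<not> s), (g, s)] []"
    using pres_eq.cancel[of R g "\<not> s"] by simp
  from pres_eq.append[OF pres_eq.refl pres_eq.append[OF this pres_eq.refl]]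
  have "pres_eq R (word_inv w @ [(g, \<not> s), (g, s)] @ w) (word_inv w @ [] @ w)" .
  with Cons show ?case
    by (auto simp: word_inv_def x intro: pres_eq.trans)
qed

lemma group_presented_group: "group (presented_group R)"
proof (rule groupI)
  fix x assume "x \<in> carrier (presented_group R)"
  then obtain w where w: "x = word_class R w"
    by (auto simp: presented_group_def)
  have one: "\<one>\<^bsub>presented_group R\<^esub> = word_class R []"
    by (simp add: presented_group_def)
  show "\<one>\<^bsub>presented_group R\<^esub> \<otimes>\<^bsub>presented_group R\<^esub> x = x"
    by (simp add: w one presented_group_mult)
  have "word_class R (word_inv w) \<otimes>\<^bsub>presented_group R\<^esub> x = \<one>\<^bsub>presented_group R\<^esub>"
    by (simp add: w one presented_group_mult word_class_eq_iff pres_eq_word_inv)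
  thus "\<exists>y\<in>carrier (presented_group R). y \<otimes>\<^bsub>presented_group R\<^esub> x = \<one>\<^bsub>presented_group R\<^esub>"
    by (auto simp: presented_group_def)
next
  fix x y z
  assume "x \<in> carrier (presented_group R)" "y \<in> carrier (presented_group R)"
    "z \<in> carrier (presented_group R)"
  then obtain u v w where "x = word_class R u" "y = word_class R v" "z = word_class R w"
    by (auto simp: presented_group_def)
  thus "x \<otimes>\<^bsub>presented_group R\<^esub> y \<otimes>\<^bsub>presented_group R\<^esub> z =
        x \<otimes>\<^bsub>presented_group R\<^esub> (y \<otimes>\<^bsub>presented_group R\<^esub> z)"
    by (simp add: presented_group_mult)
next
  fix x y
  assume "x \<in> carrier (presented_group R)" "y \<in> carrier (presented_group R)"
  then obtain u v where "x = word_class R u" "y = word_class R v"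
    by (auto simp: presented_group_def)
  thus "x \<otimes>\<^bsub>presented_group R\<^esub> y \<in> carrier (presented_group R)"
    by (simp add: presented_group_mult) (simp add: presented_group_def)
qed (simp add: presented_group_def)


section \<open>The groups \<open>G\<^sub>2(e; k, l)\<close>\<close>

datatype gen = GenA | GenB

definition G2_relations :: "nat \<Rightarrow> nat \<Rightarrow> nat \<Rightarrow> (gen word \<times> gen word) set" where
  "G2_relations e k l =
    (let n = 2 ^ e; a = word_gen GenA; b = word_gen GenB;
         a2 = word_pow a 2; b2 = word_pow b 2;
         z = word_pow a (n div 2) @ word_pow b (n div 2)
     in {(word_pow a n, []),
         (word_pow b n, []),
         (word_comm b2 a2, []),
         (word_comm b a, a2 @ word_inv b2 @ word_pow z k),
         (word_conj b2 a, word_inv b2 @ word_pow z l),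
         (word_conj a2 b, word_inv a2 @ word_pow z l)})"

definition G2 :: "nat \<Rightarrow> nat \<Rightarrow> nat \<Rightarrow> gen word set monoid" where
  "G2 e k l = presented_group (G2_relations e k l)"

definition G2_a :: "nat \<Rightarrow> nat \<Rightarrow> nat \<Rightarrow> gen word set" where
  "G2_a e k l = word_class (G2_relations e k l) (word_gen GenA)"

definition G2_b :: "nat \<Rightarrow> nat \<Rightarrow> nat \<Rightarrow> gen word set" where
  "G2_b e k l = word_class (G2_relations e k l) (word_gen GenB)"

lemma group_G2: "group (G2 e k l)"
  unfolding G2_def by (rule group_presented_group)

text \<open>
  The first conjunct is the parity condition; it makes \<open>f + h - i - j\<close> even, so that the
  division in the congruence is exact.
\<close>

definition iso_params ::
    "nat \<Rightarrow> nat \<Rightarrow> nat \<Rightarrow> nat \<Rightarrow> int \<Rightarrow> int \<Rightarrow> int \<Rightarrow> int \<Rightarrow> bool" where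
  "iso_params k1 l1 k l i j f h \<longleftrightarrow>
     (odd i \<and> odd h \<and> even j \<and> even f \<or> even i \<and> even h \<and> odd j \<and> odd f) \<and>
     l1 = l \<and>
     [int k1 = int k + (int l * (f + h - i - j)) div 2] (mod 2)"

definition gens_mapped_to ::
    "nat \<Rightarrow> nat \<Rightarrow> nat \<Rightarrow> nat \<Rightarrow> nat \<Rightarrow> (gen word set \<Rightarrow> gen word set) \<Rightarrow>
     int \<Rightarrow> int \<Rightarrow> int \<Rightarrow> int \<Rightarrow> bool" where
  "gens_mapped_to e k1 l1 k l \<sigma> i j f h \<longleftrightarrow>
     \<sigma> (G2_a e k1 l1) = G2_a e k l [^]\<^bsub>G2 e k l\<^esub> i \<otimes>\<^bsub>G2 e k l\<^esub> G2_b e k l [^]\<^bsub>G2 e k l\<^esub> j \<and>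
     \<sigma> (G2_b e k1 l1) = G2_a e k l [^]\<^bsub>G2 e k l\<^esub> f \<otimes>\<^bsub>G2 e k l\<^esub> G2_b e k l [^]\<^bsub>G2 e k l\<^esub> h"

end

theory Submission
  imports Defs "HOL-Algebra.Generated_Groups"
begin

text \<open>
  Write \<open>n = 4 \<mu>\<close> and \<open>z = a\<^bsup>n/2\<^esup> b\<^bsup>n/2\<^esup>\<close>, which is central and of order two. The relations make every
  element a normal form \<open>P i j = a\<^sup>i b\<^sup>j\<close>, and moving \<open>b\<^sup>j\<close> past \<open>a\<^sup>f\<close> only changes signs, according to the
  parities of \<open>j\<close> and \<open>f\<close>, and produces a power of \<open>z\<close>. The resulting multiplication on pairs of
  residues modulo \<open>n\<close> is associative because the exponent of \<open>z\<close> is a cocycle modulo 2, so \<open>i\<close> and \<open>j\<close>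
  are unique modulo \<open>n\<close> and the group has order \<open>n\<^sup>2\<close>.

  For \<open>x = a\<^sup>i b\<^sup>j\<close> and \<open>y = a\<^sup>f b\<^sup>h\<close> of the right parities, \<open>x\<^bsup>n/2\<^esup> y\<^bsup>n/2\<^esup> = z\<close>, and \<open>x\<close>, \<open>y\<close> satisfy the defining
  relations with the same \<open>l\<close> and with \<open>k\<close> replaced by \<open>k + l (f + h - i - j) / 2\<close>; moreover they
  generate, so that comparing orders gives an isomorphism. Conversely, if \<open>x\<close> and \<open>y\<close> are the images of
  the generators, then \<open>(i, j)\<close> and \<open>(f, h)\<close> are independent modulo 2, and neither is \<open>(1, 1)\<close>
  because the square of \<open>a\<^sup>i b\<^sup>j\<close> with \<open>i\<close>, \<open>j\<close> odd is a power of \<open>z\<close>, which makes its order less than \<open>n\<close>.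
\<close>

section \<open>Evaluating words in a group\<close>

definition word_eval :: "('a, 'm) monoid_scheme \<Rightarrow> ('g \<Rightarrow> 'a) \<Rightarrow> 'g word \<Rightarrow> 'a" where
  "word_eval H \<phi> w =
     foldr (\<lambda>(g, s) y. (if s then \<phi> g else inv\<^bsub>H\<^esub> \<phi> g) \<otimes>\<^bsub>H\<^esub> y) w \<one>\<^bsub>H\<^esub>"

context group
begin

context
  fixes \<phi> :: "'g \<Rightarrow> 'a"
  assumes gens: "\<And>g. \<phi> g \<in> carrier G"
begin

lemma word_eval_closed [simp]: "word_eval G \<phi> w \<in> carrier G"
  by (induction w) (auto simp: word_eval_def gens)

lemma word_eval_gen [simp]: "word_eval G \<phi> (word_gen g) = \<phi> g"
  by (simp add: word_eval_def word_gen_def gens)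

lemma word_eval_Nil [simp]: "word_eval G \<phi> [] = \<one>"
  by (simp add: word_eval_def)

lemma word_eval_append [simp]: "word_eval G \<phi> (u @ v) = word_eval G \<phi> u \<otimes> word_eval G \<phi> v"
proof (induction u)
  case Nil
  show ?case using word_eval_closed[of v] by (simp add: word_eval_def)
next
  case (Cons p u)
  then show ?case
    using word_eval_closed[of u] word_eval_closed[of v]
    by (auto simp: word_eval_def m_assoc gens split: prod.splits)
qed

lemma word_eval_inv [simp]: "word_eval G \<phi> (word_inv w) = inv (word_eval G \<phi> w)"
proof (induction w)
  case Nil
  show ?case by (simp add: word_inv_def)
next
  case (Cons p w)
  obtain g s where p: "p = (g, s)" by (cases p)
  have "word_inv (p # w) = word_inv w @ [(g, \<not> s)]" "p # w = [(g, s)] @ w"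
    by (simp_all add: word_inv_def p)
  moreover have "word_eval G \<phi> [(g, \<not> s)] = inv (word_eval G \<phi> [(g, s)])"
    by (simp add: word_eval_def gens)
  ultimately show ?case
    using Cons by (simp only: word_eval_append inv_mult_group word_eval_closed)
qed

lemma word_eval_pow [simp]: "word_eval G \<phi> (word_pow w n) = word_eval G \<phi> w [^] n"
proof (induction n)
  case 0
  show ?case by (simp add: word_pow_def)
next
  case (Suc n)
  have "word_pow w (Suc n) = w @ word_pow w n" by (simp add: word_pow_def)
  with Suc show ?case by (simp only: word_eval_append nat_pow_Suc2 word_eval_closed)
qed

lemma word_eval_cong:
  assumes R: "\<And>u v. (u, v) \<in> R \<Longrightarrow> word_eval G \<phi> u = word_eval G \<phi> v"
    and "pres_eq R u v"
  shows "word_eval G \<phi> u = word_eval G \<phi> v"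
  using assms(2)
proof induction
  case (cancel g s)
  show ?case by (simp add: word_eval_def gens)
qed (simp_all add: R)

text \<open>Von Dyck's theorem: a choice of images that respects the relations extends to the
  presented group. The map evaluates a representative chosen by \<open>SOME\<close>;
  \<open>word_eval_cong\<close> makes the choice immaterial.\<close>

lemma presented_group_hom_exists:
  assumes R: "\<And>u v. (u, v) \<in> R \<Longrightarrow> word_eval G \<phi> u = word_eval G \<phi> v"
  obtains \<sigma> where "\<sigma> \<in> hom (presented_group R) G"
    and "\<And>w. \<sigma> (word_class R w) = word_eval G \<phi> w"
proof
  define \<sigma> where "\<sigma> = (\<lambda>X. word_eval G \<phi> (SOME w. X = word_class R w))"
  show \<sigma>: "\<sigma> (word_class R w) = word_eval G \<phi> w" for w
  proof -
    have "word_class R w = word_class R (SOME v. word_class R w = word_class R v)"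
      by (rule someI) (rule HOL.refl)
    then show ?thesis
      unfolding \<sigma>_def word_class_eq_iff using word_eval_cong[OF R] by metis
  qed
  show "\<sigma> \<in> hom (presented_group R) G"
  proof (rule homI)
    fix X assume "X \<in> carrier (presented_group R)"
    then show "\<sigma> X \<in> carrier G" by (auto simp: presented_group_def \<sigma>)
  next
    fix X Y assume "X \<in> carrier (presented_group R)" "Y \<in> carrier (presented_group R)"
    then obtain u v where "X = word_class R u" "Y = word_class R v"
      by (auto simp: presented_group_def)
    then show "\<sigma> (X \<otimes>\<^bsub>presented_group R\<^esub> Y) = \<sigma> X \<otimes> \<sigma> Y"
      by (simp add: presented_group_mult \<sigma>)
  qed
qed

end

end

lemma word_class_closed [simp]: "word_class R w \<in> carrier (presented_group R)"
  by (simp add: presented_group_def)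

text \<open>Links the quotient of words to products in the group: it shows both that the generator
  classes satisfy the relations and that every class is a product of generators and their
  inverses.\<close>

lemma word_eval_presented_group:
  "word_eval (presented_group R) (\<lambda>g. word_class R (word_gen g)) w = word_class R w"
proof -
  interpret group "presented_group R" by (rule group_presented_group)
  let ?\<phi> = "\<lambda>g. word_class R (word_gen g)"
  have gens: "?\<phi> g \<in> carrier (presented_group R)" for g by simp
  have inv: "inv\<^bsub>presented_group R\<^esub> ?\<phi> g = word_class R [(g, False)]" for g
  proof (rule inv_equality)
    show "word_class R [(g, False)] \<otimes>\<^bsub>presented_group R\<^esub> ?\<phi> g = \<one>\<^bsub>presented_group R\<^esub>"
      using pres_eq.cancel[of R g False]
      by (simp only: presented_group_mult) (simp add: presented_group_def word_class_eq_iff word_gen_def)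
  qed simp_all
  show ?thesis
  proof (induction w)
    case Nil
    show ?case by (simp add: word_eval_def presented_group_def)
  next
    case (Cons p w)
    obtain g s where p: "p = (g, s)" by (cases p)
    have "word_eval (presented_group R) ?\<phi> (p # w) =
        (if s then ?\<phi> g else inv\<^bsub>presented_group R\<^esub> ?\<phi> g) \<otimes>\<^bsub>presented_group R\<^esub> word_class R w"
      using Cons by (simp add: word_eval_def p)
    then show ?case
      unfolding inv by (simp add: presented_group_mult p word_gen_def)
  qed
qed

section \<open>Normal forms\<close>

text \<open>\<open>alt j i\<close> is \<open>(-1)\<^sup>j i\<close>, and \<open>twist k l j f\<close> is the exponent of \<open>z\<close> that appears when \<open>b\<^sup>j\<close> is moved past \<open>a\<^sup>f\<close>.\<close>

definition alt :: "int \<Rightarrow> int \<Rightarrow> int" where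
  "alt j i = (if even j then i else - i)"

definition twist :: "int \<Rightarrow> int \<Rightarrow> int \<Rightarrow> int \<Rightarrow> int" where
  "twist k l j f =
     (if odd j then if odd f then k + l * ((j + f) div 2) else l * (f div 2)
      else if odd f then l * (j div 2) else 0)"

lemma cong_imp_shift: "[x = y] (mod n) \<Longrightarrow> \<exists>s. x = y + n * s" for x y n :: int
  by (drule cong_sym) (simp add: cong_iff_lin)

section \<open>Powers under conjugation, and consequences of the defining relations\<close>

context group
begin

text \<open>The hypothesis says that conjugation by y takes x to w, and conjugation respects powers,
  negative ones included.\<close>

lemma int_pow_swap:
  fixes i :: int
  assumes [simp]: "x \<in> carrier G" "y \<in> carrier G" "w \<in> carrier G" and swap: "x \<otimes> y = y \<otimes> w"
  shows "x [^] i \<otimes> y = y \<otimes> w [^] i"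
proof (induction i rule: int_induct[where k = 0])
  case (step1 i)
  have "x [^] (i + 1) \<otimes> y = x [^] i \<otimes> y \<otimes> w"
    by (simp add: int_pow_mult m_assoc swap)
  also have "\<dots> = y \<otimes> w [^] (i + 1)"
    by (simp add: step1 int_pow_mult m_assoc)
  finally show ?case .
next
  case (step2 i)
  have "inv x \<otimes> y = y \<otimes> inv w"
    by (metis assms inv_closed inv_solve_left inv_solve_right m_assoc m_closed)
  then have "x [^] (i - 1) \<otimes> y = x [^] i \<otimes> y \<otimes> inv w"
    by (simp add: int_pow_diff m_assoc)
  also have "\<dots> = y \<otimes> w [^] (i - 1)"
    by (simp add: step2 int_pow_diff m_assoc)
  finally show ?case .
qed simp

lemma int_pow_commute:
  fixes i j :: int
  assumes "x \<in> carrier G" "y \<in> carrier G" "x \<otimes> y = y \<otimes> x"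
  shows "x [^] i \<otimes> y [^] j = y [^] j \<otimes> x [^] i"
  using assms int_pow_swap by (metis int_pow_closed)

lemma int_pow_mult_left:
  fixes i j :: int
  assumes "x \<in> carrier G" "y \<in> carrier G"
  shows "x [^] i \<otimes> (x [^] j \<otimes> y) = x [^] (i + j) \<otimes> y"
  using assms by (simp add: int_pow_mult m_assoc)

end

text \<open>The relations are freed of commutators and inverses, and \<open>\<mu>\<close>,
  \<open>k\<close>, \<open>l\<close> are integers, so that parameters computed from arbitrary
  exponents can be inserted directly. \<open>parity\<close> reflects the convention k = l = 0 for n
  = 4, that is, for \<open>\<mu>\<close> = 1.\<close>

locale G2_group = group G for G (structure) +
  fixes a b :: 'a and \<mu> k l :: int
  assumes a_closed [simp, intro]: "a \<in> carrier G" and b_closed [simp, intro]: "b \<in> carrier G"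
    and parity: "even \<mu> \<or> k = 0 \<and> l = 0"
    and a_order: "a [^] (4 * \<mu>) = \<one>" and b_order: "b [^] (4 * \<mu>) = \<one>"
    and squares_commute: "b [^] (2::int) \<otimes> a [^] (2::int) = a [^] (2::int) \<otimes> b [^] (2::int)"
    and comm: "b \<otimes> a = a \<otimes> b \<otimes> (a [^] (2::int) \<otimes> b [^] (-2::int) \<otimes>
                 (a [^] (2 * \<mu>) \<otimes> b [^] (2 * \<mu>)) [^] k)"
    and conj_b2: "b [^] (2::int) \<otimes> a =
                    a \<otimes> (b [^] (-2::int) \<otimes> (a [^] (2 * \<mu>) \<otimes> b [^] (2 * \<mu>)) [^] l)"
    and conj_a2: "a [^] (2::int) \<otimes> b =
                    b \<otimes> (a [^] (-2::int) \<otimes> (a [^] (2 * \<mu>) \<otimes> b [^] (2 * \<mu>)) [^] l)"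
begin

definition z :: 'a where "z = a [^] (2 * \<mu>) \<otimes> b [^] (2 * \<mu>)"

lemma z_closed [simp]: "z \<in> carrier G"
  by (simp add: z_def)

lemma even_powers_commute:
  fixes i j :: int
  shows "b [^] (2 * j) \<otimes> a [^] (2 * i) = a [^] (2 * i) \<otimes> b [^] (2 * j)"
  using int_pow_commute[OF _ _ squares_commute, of j i] by (simp add: int_pow_pow)

lemma a_period: "a [^] (i + 4 * \<mu> * t) = a [^] i"
  using a_order by (simp add: int_pow_mult flip: int_pow_pow)

lemma b_period: "b [^] (i + 4 * \<mu> * t) = b [^] i"
  using b_order by (simp add: int_pow_mult flip: int_pow_pow)

lemma z_pow: fixes t :: int shows "z [^] t = a [^] (2 * \<mu> * t) \<otimes> b [^] (2 * \<mu> * t)"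
  unfolding z_def using even_powers_commute[of \<mu> \<mu>]
  by (simp add: int_pow_mult_distrib int_pow_pow)

lemma z_pow_even: "even (t :: int) \<Longrightarrow> z [^] t = \<one>"
  using a_period[of 0] b_period[of 0] by (auto simp: z_pow mult.assoc elim!: evenE)

lemma even_l_mu: "even (l * \<mu>)"
  using parity by auto

text \<open>Centrality of z is derived later from \<open>b_even_a\<close> and
  \<open>a_even_b\<close>. Their proofs have to split a power of b^-2 z^l or a^-2 z^l, for which
  commutation with even powers suffices.\<close>

lemma z_b_even: "z \<otimes> b [^] (2 * j) = b [^] (2 * j) \<otimes> z" for j :: int
proof -
  have "z \<otimes> b [^] (2 * j) = a [^] (2 * \<mu>) \<otimes> b [^] (2 * j) \<otimes> b [^] (2 * \<mu>)"
    by (simp add: z_def m_assoc add.commute flip: int_pow_mult)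
  then show ?thesis
    by (simp add: z_def m_assoc flip: even_powers_commute)
qed

lemma z_a_even: "z \<otimes> a [^] (2 * j) = a [^] (2 * j) \<otimes> z" for j :: int
proof -
  have "z \<otimes> a [^] (2 * j) = a [^] (2 * \<mu>) \<otimes> a [^] (2 * j) \<otimes> b [^] (2 * \<mu>)"
    by (simp add: z_def m_assoc even_powers_commute)
  also have "\<dots> = a [^] (2 * j) \<otimes> z"
    by (simp add: z_def int_pow_mult_left add.commute flip: int_pow_mult)
  finally show ?thesis .
qed

lemma b_even_a: fixes j :: int shows "b [^] (2 * j) \<otimes> a = a \<otimes> (b [^] (- 2 * j) \<otimes> z [^] (l * j))"
proof -
  let ?w = "b [^] (-2::int) \<otimes> z [^] l"
  have "z [^] l \<otimes> b [^] (-2::int) = b [^] (-2::int) \<otimes> z [^] l"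
    using int_pow_swap[of z "b [^] (-2::int)" z l] z_b_even[of "-1"] by simp
  then have "?w [^] j = b [^] (- 2 * j) \<otimes> z [^] (l * j)"
    by (simp add: int_pow_mult_distrib int_pow_pow)
  moreover have "(b [^] (2::int)) [^] j \<otimes> a = a \<otimes> ?w [^] j"
    by (rule int_pow_swap) (use conj_b2 in \<open>simp_all add: z_def\<close>)
  ultimately show ?thesis by (simp add: int_pow_pow)
qed

lemma a_even_b: fixes j :: int shows "a [^] (2 * j) \<otimes> b = b \<otimes> (a [^] (- 2 * j) \<otimes> z [^] (l * j))"
proof -
  let ?w = "a [^] (-2::int) \<otimes> z [^] l"
  have "z [^] l \<otimes> a [^] (-2::int) = a [^] (-2::int) \<otimes> z [^] l"
    using int_pow_swap[of z "a [^] (-2::int)" z l] z_a_even[of "-1"] by simp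
  then have "?w [^] j = a [^] (- 2 * j) \<otimes> z [^] (l * j)"
    by (simp add: int_pow_mult_distrib int_pow_pow)
  moreover have "(a [^] (2::int)) [^] j \<otimes> b = b \<otimes> ?w [^] j"
    by (rule int_pow_swap) (use conj_a2 in \<open>simp_all add: z_def\<close>)
  ultimately show ?thesis by (simp add: int_pow_pow)
qed

text \<open>For j = \<open>\<mu>\<close>, \<open>a_even_b\<close> moves b past the power
  2\<open>\<mu>\<close> of a at the cost of inverting that power and adding
  z^(l\<open>\<mu>\<close>). The inversion has no effect because a^(4\<open>\<mu>\<close>) = 1, and
  l\<open>\<mu>\<close> is even.\<close>

lemma a_half_central: fixes t j :: int shows "a [^] (2 * \<mu> * t) \<otimes> b [^] j = b [^] j \<otimes> a [^] (2 * \<mu> * t)"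
proof -
  have "a [^] (2 * \<mu>) \<otimes> b = b \<otimes> a [^] (2 * \<mu>)"
    using a_even_b[of \<mu>] a_period[of "-2 * \<mu>" 1] by (simp add: z_pow_even[OF even_l_mu])
  from int_pow_commute[OF _ _ this] show ?thesis
    by (simp add: int_pow_pow)
qed

lemma b_half_central: fixes t j :: int shows "b [^] (2 * \<mu> * t) \<otimes> a [^] j = a [^] j \<otimes> b [^] (2 * \<mu> * t)"
proof -
  have "b [^] (2 * \<mu>) \<otimes> a = a \<otimes> b [^] (2 * \<mu>)"
    using b_even_a[of \<mu>] b_period[of "-2 * \<mu>" 1] by (simp add: z_pow_even[OF even_l_mu])
  from int_pow_commute[OF _ _ this] show ?thesis
    by (simp add: int_pow_pow)
qed

lemma z_a: fixes t i :: int shows "z [^] t \<otimes> a [^] i = a [^] i \<otimes> z [^] t"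
proof -
  have "z [^] t \<otimes> a [^] i = a [^] (2 * \<mu> * t) \<otimes> (b [^] (2 * \<mu> * t) \<otimes> a [^] i)"
    by (simp add: z_pow m_assoc)
  also have "\<dots> = a [^] i \<otimes> z [^] t"
    unfolding b_half_central by (simp add: z_pow int_pow_mult_left add.commute)
  finally show ?thesis .
qed

lemma z_b: fixes t i :: int shows "z [^] t \<otimes> b [^] i = b [^] i \<otimes> z [^] t"
proof -
  have "z [^] t \<otimes> b [^] i = (a [^] (2 * \<mu> * t) \<otimes> b [^] i) \<otimes> b [^] (2 * \<mu> * t)"
    by (simp add: z_pow m_assoc add.commute flip: int_pow_mult)
  also have "\<dots> = b [^] i \<otimes> z [^] t"
    unfolding a_half_central by (simp add: z_pow m_assoc)
  finally show ?thesis .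
qed

lemma z_left:
  fixes t i :: int
  assumes "y \<in> carrier G"
  shows "z [^] t \<otimes> (a [^] i \<otimes> y) = a [^] i \<otimes> (z [^] t \<otimes> y)"
    "z [^] t \<otimes> (b [^] i \<otimes> y) = b [^] i \<otimes> (z [^] t \<otimes> y)"
  using assms by (simp_all add: z_a z_b flip: m_assoc)

lemma even_powers_commute_left:
  fixes i j :: int
  assumes "y \<in> carrier G"
  shows "b [^] (2 * j) \<otimes> (a [^] (2 * i) \<otimes> y) = a [^] (2 * i) \<otimes> (b [^] (2 * j) \<otimes> y)"
  using assms by (simp add: even_powers_commute flip: m_assoc)

lemma b_a_even: fixes f :: int shows "b \<otimes> a [^] (2 * f) = a [^] (- 2 * f) \<otimes> (b \<otimes> z [^] (l * f))"
proof -
  have "a [^] (- 2 * f) \<otimes> b \<otimes> z [^] (l * f) = b \<otimes> a [^] (2 * f) \<otimes> z [^] (- l * f + l * f)"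
    using a_even_b[of "- f"] by (simp add: m_assoc flip: int_pow_mult)
  then show ?thesis by (simp add: m_assoc)
qed

text \<open>Odd exponents are split into an even part and a single generator. Even powers commute
  with each other, and an even power passes the other generator by changing sign and leaving a power
  of z. Only the odd-odd case uses \<open>comm\<close>, which contributes k.\<close>

lemma swap_ba: "b [^] j \<otimes> a [^] f = a [^] alt j f \<otimes> (b [^] alt f j \<otimes> z [^] twist k l j f)"
proof (cases "even j"; cases "even f")
  assume j: "even j" and f: "even f"
  then show ?thesis
    by (auto simp: alt_def twist_def even_powers_commute elim!: evenE)
next
  assume "even j" "odd f"
  then obtain j' f' where [simp]: "j = 2 * j'" "f = 1 + 2 * f'" by (metis evenE oddE add.commute)
  have "b [^] j \<otimes> a [^] f = b [^] (2 * j') \<otimes> a \<otimes> a [^] (2 * f')"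
    by (simp add: int_pow_mult m_assoc)
  also have "\<dots> = a [^] (1::int) \<otimes> (a [^] (2 * f') \<otimes> (b [^] (2 * - j') \<otimes> z [^] (l * j')))"
    unfolding b_even_a using even_powers_commute_left[of "z [^] (l * j')" "- j'" f']
    by (simp add: m_assoc z_a)
  also have "\<dots> = a [^] f \<otimes> (b [^] (- j) \<otimes> z [^] (l * j'))"
    by (simp add: int_pow_mult_left del: int_pow_1)
  finally show ?thesis by (simp add: alt_def twist_def)
next
  assume "odd j" "even f"
  then obtain j' f' where [simp]: "j = 2 * j' + 1" "f = 2 * f'" by (metis evenE oddE)
  have "b [^] j \<otimes> a [^] f = b [^] (2 * j') \<otimes> (b \<otimes> a [^] (2 * f'))"
    by (simp add: int_pow_mult m_assoc)
  also have "\<dots> = a [^] (2 * - f') \<otimes> (b [^] (2 * j') \<otimes> (b [^] (1::int) \<otimes> z [^] (l * f')))"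
    unfolding b_a_even using even_powers_commute_left[of "b \<otimes> z [^] (l * f')" j' "- f'"]
    by simp
  also have "\<dots> = a [^] (- f) \<otimes> (b [^] j \<otimes> z [^] (l * f'))"
    by (simp add: int_pow_mult_left del: int_pow_1)
  finally show ?thesis by (simp add: alt_def twist_def)
next
  assume "odd j" "odd f"
  then obtain j' f' where [simp]: "j = 2 * j' + 1" "f = 1 + 2 * f'" by (metis oddE add.commute)
  have 1: "a [^] (2::int) \<otimes> b [^] (-2::int) \<otimes> z [^] k \<otimes> a [^] (2 * f') =
      a [^] (2 * (f' + 1)) \<otimes> (b [^] (-2::int) \<otimes> z [^] k)"
    using even_powers_commute_left[of "z [^] k" "-1" f']
    by (simp add: m_assoc z_a int_pow_mult_left add.commute)
  have "b [^] j \<otimes> a [^] f = b [^] (2 * j') \<otimes> (b \<otimes> a) \<otimes> a [^] (2 * f')"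
    by (simp add: int_pow_mult m_assoc)
  \<comment> \<open>After \<open>comm\<close> the product is cut behind the first a:
    \<open>b_even_a\<close> rewrites the left factor and \<open>b_a_even\<close> the right
    one.\<close>
  also have "\<dots> = (b [^] (2 * j') \<otimes> a) \<otimes>
      (b \<otimes> (a [^] (2::int) \<otimes> b [^] (-2::int) \<otimes> z [^] k \<otimes> a [^] (2 * f')))"
    unfolding comm by (simp add: m_assoc z_def)
  also have "b \<otimes> (a [^] (2::int) \<otimes> b [^] (-2::int) \<otimes> z [^] k \<otimes> a [^] (2 * f')) =
      (b \<otimes> a [^] (2 * (f' + 1))) \<otimes> (b [^] (-2::int) \<otimes> z [^] k)"
    unfolding 1 by (simp add: m_assoc)
  also have "\<dots> = a [^] (2 * - (f' + 1)) \<otimes> (b [^] (-1::int) \<otimes> z [^] (l * (f' + 1) + k))"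
    unfolding b_a_even
    using int_pow_mult_left[of b "z [^] (l * (f' + 1) + k)" 1 "-2"]
    by (simp add: m_assoc z_left int_pow_mult)
  also have "b [^] (2 * j') \<otimes> a = a [^] (1::int) \<otimes> (b [^] (2 * - j') \<otimes> z [^] (l * j'))"
    unfolding b_even_a by simp
  also have "a [^] (1::int) \<otimes> (b [^] (2 * - j') \<otimes> z [^] (l * j')) \<otimes>
      (a [^] (2 * - (f' + 1)) \<otimes> (b [^] (-1::int) \<otimes> z [^] (l * (f' + 1) + k))) =
      a [^] (1 + 2 * - (f' + 1)) \<otimes> (b [^] (2 * - j' + -1) \<otimes> z [^] (l * j' + (l * (f' + 1) + k)))"
    by (simp only: m_assoc z_left even_powers_commute_left int_pow_mult_left int_pow_closed m_closed
        a_closed b_closed z_closed int_pow_mult[symmetric])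
  \<comment> \<open>The exponents of a and b are -f and -j, and j' + f' + 1 is half of j + f, as
    \<open>twist\<close> requires.\<close>
  also have "\<dots> = a [^] (- f) \<otimes> (b [^] (- j) \<otimes> z [^] twist k l j f)"
  proof -
    have "(2 * j' + 1 + (1 + 2 * f')) div 2 = j' + f' + 1" by presburger
    then show ?thesis by (simp add: twist_def algebra_simps)
  qed
  finally show ?thesis by (simp add: alt_def)
qed

definition P :: "int \<Rightarrow> int \<Rightarrow> 'a" where "P i j = a [^] i \<otimes> b [^] j"

lemma P_closed [simp]: "P i j \<in> carrier G"
  by (simp add: P_def)

lemma P_mult:
  "P i j \<otimes> P f h =
     P (i + alt j f + 2 * \<mu> * twist k l j f) (alt f j + h + 2 * \<mu> * twist k l j f)"
proof -
  let ?t = "twist k l j f"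
  have "P i j \<otimes> P f h = a [^] i \<otimes> (b [^] j \<otimes> a [^] f) \<otimes> b [^] h"
    by (simp add: P_def m_assoc)
  also have "\<dots> = a [^] (i + alt j f) \<otimes> (b [^] (alt f j + h) \<otimes> z [^] ?t)"
    unfolding swap_ba by (simp add: m_assoc z_b int_pow_mult_left)
  also have "\<dots> = a [^] (i + alt j f) \<otimes> (z [^] ?t \<otimes> b [^] (alt f j + h))"
    by (simp add: z_b)
  also have "\<dots> = P (i + alt j f + 2 * \<mu> * ?t) (alt f j + h + 2 * \<mu> * ?t)"
    by (simp add: z_pow P_def m_assoc int_pow_mult_left) (simp add: add.commute m_assoc flip: int_pow_mult)
  finally show ?thesis .
qed

lemma P_cong: "[i = i'] (mod (4 * \<mu>)) \<Longrightarrow> [j = j'] (mod (4 * \<mu>)) \<Longrightarrow> P i j = P i' j'"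
  unfolding P_def by (auto dest!: cong_imp_shift simp: a_period b_period)

end

section \<open>The model on pairs of residues\<close>

text \<open>A multiple of the half-period 2\<open>\<mu>\<close> is its own negative modulo
  4\<open>\<mu>\<close>, so the corrections coming from z are insensitive to signs.\<close>

lemma alt_shift: "[alt j (2 * \<mu> * t) = 2 * \<mu> * t] (mod (4 * \<mu>))"
proof -
  have "alt j (2 * \<mu> * t) - 2 * \<mu> * t = (4 * \<mu>) * (if even j then 0 else - t)"
    by (simp add: alt_def algebra_simps)
  then show ?thesis unfolding cong_iff_dvd_diff by (metis dvd_triv_left)
qed

lemma even_or_odd: "\<exists>q. x = 2 * q \<or> x = 2 * q + 1" for x :: int
  by presburger

text \<open>The halves in \<open>twist\<close> move by multiples of \<open>\<mu>\<close>, which is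
  even unless k = l = 0. Shifts by half a period are allowed because products carry corrections of
  exactly that size.\<close>

lemma twist_shift:
  assumes "even \<mu> \<or> k = 0 \<and> l = 0"
  shows "even (twist k l (j + 2 * \<mu> * s) (f + 2 * \<mu> * t) - twist k l j f)"
proof -
  have "(j + 2 * \<mu> * s) div 2 = j div 2 + \<mu> * s" "(f + 2 * \<mu> * t) div 2 = f div 2 + \<mu> * t"
    "(j + 2 * \<mu> * s + (f + 2 * \<mu> * t)) div 2 = (j + f) div 2 + \<mu> * (s + t)"
    by (simp_all add: algebra_simps)
  then show ?thesis using assms by (auto simp: twist_def algebra_simps)
qed

text \<open>Equates, modulo 2, the exponents of z in the two bracketings of a triple product.
  Writing each argument as 2q or 2q + 1 leaves sixteen polynomial identities.\<close>

lemma twist_cocycle: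
  "even (twist k l j f + twist k l (alt f j + h) u - twist k l h u - twist k l j (f + alt h u))"
proof -
  obtain j' where j: "j = 2 * j' \<or> j = 2 * j' + 1" using even_or_odd[of j] by blast
  obtain f' where f: "f = 2 * f' \<or> f = 2 * f' + 1" using even_or_odd[of f] by blast
  obtain h' where h: "h = 2 * h' \<or> h = 2 * h' + 1" using even_or_odd[of h] by blast
  obtain u' where u: "u = 2 * u' \<or> u = 2 * u' + 1" using even_or_odd[of u] by blast
  show ?thesis
    using j f h u by (elim disjE) (auto simp: twist_def alt_def algebra_simps)
qed

lemma twist_inverse: "even (twist k l (- alt i j) i - twist k l j i)"
proof -
  obtain j' where j: "j = 2 * j' \<or> j = 2 * j' + 1" using even_or_odd[of j] by blast
  obtain i' where i: "i = 2 * i' \<or> i = 2 * i' + 1" using even_or_odd[of i] by blast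
  show ?thesis
    using j i by (elim disjE) (auto simp: twist_def alt_def algebra_simps)
qed

lemma even_diff_imp: "even (s - t) \<Longrightarrow> \<exists>w. s = t + 2 * w" for s t :: int
  by presburger

text \<open>The pair \<open>(i, j)\<close> stands for \<open>a\<^sup>i b\<^sup>j\<close>.\<close>

definition model_op :: "int \<Rightarrow> int \<Rightarrow> int \<Rightarrow> int \<times> int \<Rightarrow> int \<times> int \<Rightarrow> int \<times> int" where
  "model_op \<mu> k l p q =
     (let c = 2 * \<mu> * twist k l (snd p) (fst q)
      in (fst p + alt (snd p) (fst q) + c, alt (fst q) (snd p) + snd q + c))"

text \<open>The normal form of b^(-j) a^(-i). Replacing \<open>twist\<close> at (-j, -i) by its
  value at (j, i) changes the exponent of z by an even number only.\<close>

definition model_inv :: "int \<Rightarrow> int \<Rightarrow> int \<Rightarrow> int \<times> int \<Rightarrow> int \<times> int" where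
  "model_inv \<mu> k l p =
     (let c = 2 * \<mu> * twist k l (snd p) (fst p)
      in (- alt (snd p) (fst p) + c, - alt (fst p) (snd p) + c))"

definition cong_pair :: "int \<Rightarrow> int \<times> int \<Rightarrow> int \<times> int \<Rightarrow> bool" where
  "cong_pair n p q \<longleftrightarrow> [fst p = fst q] (mod n) \<and> [snd p = snd q] (mod n)"

definition reduce :: "int \<Rightarrow> int \<times> int \<Rightarrow> int \<times> int" where
  "reduce n p = (fst p mod n, snd p mod n)"

lemma reduce_eq_iff: "reduce n p = reduce n q \<longleftrightarrow> cong_pair n p q"
  by (simp add: reduce_def cong_pair_def cong_def)

lemma cong_pair_reduce: "cong_pair n (reduce n p) p"
  by (simp add: reduce_def cong_pair_def cong_def)

lemma even_imp_cong: "even (s - t) \<Longrightarrow> [x + 2 * \<mu> * s = x + 2 * \<mu> * t] (mod (4 * \<mu>))" for \<mu> :: int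
proof -
  assume "even (s - t)"
  then obtain w where "s = t + 2 * w" by (blast dest: even_diff_imp)
  then show ?thesis
    by (simp add: cong_iff_dvd_diff algebra_simps)
qed

context
  fixes \<mu> k l :: int
  assumes parity: "even \<mu> \<or> k = 0 \<and> l = 0"
begin

lemma model_op_cong:
  assumes "cong_pair (4 * \<mu>) p p'" "cong_pair (4 * \<mu>) q q'"
  shows "cong_pair (4 * \<mu>) (model_op \<mu> k l p q) (model_op \<mu> k l p' q')"
proof -
  obtain s t s' t' where
    p: "fst p = fst p' + 4 * \<mu> * s" "snd p = snd p' + 4 * \<mu> * t" and
    q: "fst q = fst q' + 4 * \<mu> * s'" "snd q = snd q' + 4 * \<mu> * t'"
    using assms unfolding cong_pair_def by (blast dest: cong_imp_shift)
  let ?c = "twist k l (snd p) (fst q)" and ?c' = "twist k l (snd p') (fst q')"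
  have "even (?c - ?c')"
    using twist_shift[OF parity, of "snd p'" "2 * t" "fst q'" "2 * s'"] p q
    by (simp add: mult.assoc)
  then obtain w where w: "?c = ?c' + 2 * w" by (blast dest: even_diff_imp)
  have "even (snd p) = even (snd p')" "even (fst q) = even (fst q')"
    by (simp_all add: p q)
  then have "fst p + alt (snd p) (fst q) + 2 * \<mu> * (?c' + 2 * w) =
      fst p' + alt (snd p') (fst q') + 2 * \<mu> * ?c' + 4 * \<mu> * (s + alt (snd p') s' + w)"
    "alt (fst q) (snd p) + snd q + 2 * \<mu> * (?c' + 2 * w) =
      alt (fst q') (snd p') + snd q' + 2 * \<mu> * ?c' + 4 * \<mu> * (alt (fst q') t + t' + w)"
    by (simp_all add: alt_def p(1) q(2) algebra_simps) (simp_all add: p(2) q(1) algebra_simps)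
  then show ?thesis
    unfolding cong_pair_def model_op_def Let_def fst_conv snd_conv w cong_iff_dvd_diff
    by simp
qed

text \<open>Up to the corrections both bracketings have the same coordinates. A correction passes
  through a sign by \<open>alt_shift\<close> and through a later \<open>twist\<close> by
  \<open>twist_shift\<close>; what remains is the cocycle identity.\<close>

lemma model_op_assoc:
  "cong_pair (4 * \<mu>) (model_op \<mu> k l (model_op \<mu> k l p q) r) (model_op \<mu> k l p (model_op \<mu> k l q r))"
proof -
  obtain i j f h u v where [simp]: "p = (i, j)" "q = (f, h)" "r = (u, v)"
    by (cases p, cases q, cases r)
  let ?c = "twist k l j f" and ?d = "twist k l h u"
  let ?J = "alt f j + h" and ?F = "f + alt h u"
  let ?c1 = "twist k l (?J + 2 * \<mu> * ?c) u" and ?d1 = "twist k l j (?F + 2 * \<mu> * ?d)"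
  have "even (?c1 - twist k l ?J u)" "even (?d1 - twist k l j ?F)"
    using twist_shift[OF parity, of ?J ?c u 0] twist_shift[OF parity, of j 0 ?F ?d] by simp_all
  with twist_cocycle[of k l j f h u] have "even ((?c + ?c1) - (?d + ?d1))"
    by simp blast
  note * = even_imp_cong[OF this]
  have alt: "alt (?J + 2 * \<mu> * ?c) u = alt j (alt h u)"
    "alt j (?F + 2 * \<mu> * ?d) = alt j f + alt j (alt h u) + alt j (2 * \<mu> * ?d)"
    "alt u (?J + 2 * \<mu> * ?c) = alt u (alt f j) + alt u h + alt u (2 * \<mu> * ?c)"
    by (simp_all add: alt_def)
  have A: "[alt j (2 * \<mu> * ?d) = 2 * \<mu> * ?d] (mod (4 * \<mu>))"
     "[alt u (2 * \<mu> * ?c) = 2 * \<mu> * ?c] (mod (4 * \<mu>))"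
    by (rule alt_shift)+
  have "[i + alt j f + 2 * \<mu> * ?c + alt (?J + 2 * \<mu> * ?c) u + 2 * \<mu> * ?c1 =
      i + alt j (?F + 2 * \<mu> * ?d) + 2 * \<mu> * ?d1] (mod (4 * \<mu>))"
  proof -
    have "i + alt j f + 2 * \<mu> * ?c + alt (?J + 2 * \<mu> * ?c) u + 2 * \<mu> * ?c1 =
       i + alt j f + alt j (alt h u) + 2 * \<mu> * (?c + ?c1)"
      unfolding alt by (simp add: algebra_simps)
    also have "[\<dots> = i + alt j f + alt j (alt h u) + 2 * \<mu> * (?d + ?d1)] (mod (4 * \<mu>))"
      by (rule *)
    also have "i + alt j f + alt j (alt h u) + 2 * \<mu> * (?d + ?d1) =
       (i + alt j f + alt j (alt h u) + 2 * \<mu> * ?d1) + 2 * \<mu> * ?d"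
      by (simp add: algebra_simps)
    also have "[\<dots> = (i + alt j f + alt j (alt h u) + 2 * \<mu> * ?d1) + alt j (2 * \<mu> * ?d)] (mod (4 * \<mu>))"
      using A(1) by (intro cong_add cong_refl) (rule cong_sym)
    also have "(i + alt j f + alt j (alt h u) + 2 * \<mu> * ?d1) + alt j (2 * \<mu> * ?d) =
       i + alt j (?F + 2 * \<mu> * ?d) + 2 * \<mu> * ?d1"
      unfolding alt by simp
    finally show ?thesis .
  qed
  moreover have "[alt u (?J + 2 * \<mu> * ?c) + v + 2 * \<mu> * ?c1 =
      alt (?F + 2 * \<mu> * ?d) j + (alt u h + v + 2 * \<mu> * ?d) + 2 * \<mu> * ?d1] (mod (4 * \<mu>))"
  proof -
    have "alt u (?J + 2 * \<mu> * ?c) + v + 2 * \<mu> * ?c1 =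
       (alt u (alt f j) + alt u h + v + 2 * \<mu> * ?c1) + alt u (2 * \<mu> * ?c)"
      unfolding alt by simp
    also have "[\<dots> = (alt u (alt f j) + alt u h + v + 2 * \<mu> * ?c1) + 2 * \<mu> * ?c] (mod (4 * \<mu>))"
      using A(2) by (intro cong_add cong_refl)
    also have "(alt u (alt f j) + alt u h + v + 2 * \<mu> * ?c1) + 2 * \<mu> * ?c =
       alt u (alt f j) + alt u h + v + 2 * \<mu> * (?c + ?c1)"
      by (simp add: algebra_simps)
    also have "[\<dots> = alt u (alt f j) + alt u h + v + 2 * \<mu> * (?d + ?d1)] (mod (4 * \<mu>))"
      by (rule *)
    also have "alt u (alt f j) + alt u h + v + 2 * \<mu> * (?d + ?d1) =
       alt (?F + 2 * \<mu> * ?d) j + (alt u h + v + 2 * \<mu> * ?d) + 2 * \<mu> * ?d1"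
      by (simp add: alt_def algebra_simps)
    finally show ?thesis .
  qed
  ultimately show ?thesis
    by (simp add: cong_pair_def model_op_def Let_def)
qed

lemma model_op_inv: "cong_pair (4 * \<mu>) (model_op \<mu> k l (model_inv \<mu> k l p) p) (0, 0)"
proof -
  obtain i j where [simp]: "p = (i, j)" by (cases p)
  let ?c = "twist k l j i"
  let ?d = "twist k l (- alt i j + 2 * \<mu> * ?c) i"
  have "even (?d - twist k l (- alt i j) i)"
    using twist_shift[OF parity, of "- alt i j" ?c i 0] by simp
  with twist_inverse[of k l i j] have "even (?d - ?c)" by simp
  then obtain w where "?d = ?c + 2 * w" by (blast dest: even_diff_imp)
  then show ?thesis
    by (auto simp: cong_pair_def model_op_def model_inv_def cong_iff_dvd_diff alt_def Let_def
        algebra_simps)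
qed

end

text \<open>A concrete group of order n^2 with n = 4\<open>\<mu>\<close>, for \<open>\<mu>\<close> >
  0 and parameters obeying the parity restriction. It serves to prove that the relations do not
  collapse the presented group any further.\<close>

definition G2_model :: "int \<Rightarrow> int \<Rightarrow> int \<Rightarrow> (int \<times> int) monoid" where
  "G2_model \<mu> k l =
     \<lparr>carrier = {0..<4 * \<mu>} \<times> {0..<4 * \<mu>},
      monoid.mult = (\<lambda>p q. reduce (4 * \<mu>) (model_op \<mu> k l p q)),
      one = (0, 0)\<rparr>"

lemma reduce_in_model: "\<mu> > 0 \<Longrightarrow> reduce (4 * \<mu>) p \<in> carrier (G2_model \<mu> k l)"
  by (simp add: reduce_def G2_model_def)

lemma reduce_model: "p \<in> carrier (G2_model \<mu> k l) \<Longrightarrow> reduce (4 * \<mu>) p = p"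
  by (auto simp: reduce_def G2_model_def)

lemma reduce_mult:
  assumes "even \<mu> \<or> k = 0 \<and> l = 0"
  shows "reduce (4 * \<mu>) p \<otimes>\<^bsub>G2_model \<mu> k l\<^esub> reduce (4 * \<mu>) q = reduce (4 * \<mu>) (model_op \<mu> k l p q)"
  unfolding G2_model_def monoid.simps reduce_eq_iff
  by (intro model_op_cong assms cong_pair_reduce)

lemma group_G2_model:
  assumes "\<mu> > 0" and par: "even \<mu> \<or> k = 0 \<and> l = 0"
  shows "group (G2_model \<mu> k l)"
proof -
  let ?M = "G2_model \<mu> k l" and ?r = "reduce (4 * \<mu>)"
  have ex: "\<exists>p'. p = ?r p'" if "p \<in> carrier ?M" for p
    using reduce_model[OF that] by metis
  have one: "\<one>\<^bsub>?M\<^esub> = ?r (0, 0)" by (simp add: G2_model_def reduce_def)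
  show ?thesis
  proof (rule groupI)
    fix p q assume "p \<in> carrier ?M" "q \<in> carrier ?M"
    then show "p \<otimes>\<^bsub>?M\<^esub> q \<in> carrier ?M"
      using assms(1) by (auto dest!: ex simp: reduce_mult[OF par] reduce_in_model)
  next
    show "\<one>\<^bsub>?M\<^esub> \<in> carrier ?M" using assms(1) by (simp add: one reduce_in_model)
  next
    fix p q r assume "p \<in> carrier ?M" "q \<in> carrier ?M" "r \<in> carrier ?M"
    then show "p \<otimes>\<^bsub>?M\<^esub> q \<otimes>\<^bsub>?M\<^esub> r = p \<otimes>\<^bsub>?M\<^esub> (q \<otimes>\<^bsub>?M\<^esub> r)"
      by (auto dest!: ex simp: reduce_mult[OF par] reduce_eq_iff model_op_assoc[OF par])
  next
    fix p assume "p \<in> carrier ?M"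
    then obtain p' where p: "p = ?r p'" using ex by blast
    show "\<one>\<^bsub>?M\<^esub> \<otimes>\<^bsub>?M\<^esub> p = p"
      unfolding one p reduce_mult[OF par] by (simp add: model_op_def twist_def alt_def)
    have "?r (model_inv \<mu> k l p') \<otimes>\<^bsub>?M\<^esub> p = \<one>\<^bsub>?M\<^esub>"
      unfolding one p reduce_mult[OF par] reduce_eq_iff by (rule model_op_inv[OF par])
    then show "\<exists>q\<in>carrier ?M. q \<otimes>\<^bsub>?M\<^esub> p = \<one>\<^bsub>?M\<^esub>"
      using reduce_in_model[OF assms(1)] by blast
  qed
qed

section \<open>The presentation as identities in a group, and their validity in the model\<close>

context group
begin

lemma int_pow_eqI:
  fixes f :: "int \<Rightarrow> 'a"
  assumes x: "x \<in> carrier G" and f: "\<And>i. f i \<in> carrier G" "f 0 = \<one>" "\<And>i. f (i + 1) = f i \<otimes> x"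
  shows "x [^] i = f i"
proof (induction i rule: int_induct[where k = 0])
  case base
  show ?case by (simp add: f)
next
  case (step1 i)
  then show ?case by (simp add: x f int_pow_mult)
next
  case (step2 i)
  have "f (i - 1) \<otimes> x = f i" using f(3)[of "i - 1"] by simp
  then have "f (i - 1) = f i \<otimes> inv x"
    using x f(1) by (metis inv_solve_right)
  then show ?case by (simp add: x step2 int_pow_diff)
qed

text \<open>Translates the hypothesis of von Dyck's theorem into the locale. The exponent is written
  d + 2 so that n = 4 * 2^d, and left inverses are moved across the equations.\<close>

lemma G2_relations_iff:
  fixes \<phi> :: "gen \<Rightarrow> 'a"
  assumes gens: "\<And>g. \<phi> g \<in> carrier G" and d: "d > 0 \<or> k = 0 \<and> l = 0"
  shows "(\<forall>(u, v) \<in> G2_relations (d + 2) k l. word_eval G \<phi> u = word_eval G \<phi> v) \<longleftrightarrow>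
    G2_group G (\<phi> GenA) (\<phi> GenB) (2 ^ d) (int k) (int l)"
proof -
  define a b where "a = \<phi> GenA" and "b = \<phi> GenB"
  have [simp]: "a \<in> carrier G" "b \<in> carrier G" by (simp_all add: a_def b_def gens)
  note eval = word_eval_gen[OF gens] word_eval_Nil[OF gens] word_eval_append[OF gens]
    word_eval_inv[OF gens] word_eval_pow[OF gens]
  define z where "z = a [^] (2 * 2 ^ d :: int) \<otimes> b [^] (2 * 2 ^ d :: int)"
  have [simp]: "z \<in> carrier G" by (simp add: z_def)
  have num: "x [^] (2::nat) = x [^] (2::int)" "x [^] (2 ^ (d + 2) :: nat) = x [^] (4 * 2 ^ d :: int)"
    "x [^] (2 ^ (d + 2) div 2 :: nat) = x [^] (2 * 2 ^ d :: int)" "x [^] m = x [^] int m"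
    for x and m :: nat
    by (simp_all flip: int_pow_int add: power_add)
  have neg: "inv (x [^] (2::int)) = x [^] (-2::int)" if "x \<in> carrier G" for x
    using that by (simp add: int_pow_neg)
  have solve: "inv y \<otimes> x = w \<longleftrightarrow> x = y \<otimes> w" if "x \<in> carrier G" "y \<in> carrier G" "w \<in> carrier G" for x y w
    using inv_solve_left[of w y x] that by auto
  have "(\<forall>(u, v) \<in> G2_relations (d + 2) k l. word_eval G \<phi> u = word_eval G \<phi> v) \<longleftrightarrow>
     a [^] (4 * 2 ^ d :: int) = \<one> \<and> b [^] (4 * 2 ^ d :: int) = \<one> \<and>
     inv (b [^] (2::int)) \<otimes> (inv (a [^] (2::int)) \<otimes> (b [^] (2::int) \<otimes> a [^] (2::int))) = \<one> \<and>
     inv b \<otimes> (inv a \<otimes> (b \<otimes> a)) = a [^] (2::int) \<otimes> (b [^] (-2::int) \<otimes> z [^] int k) \<and>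
     inv a \<otimes> (b [^] (2::int) \<otimes> a) = b [^] (-2::int) \<otimes> z [^] int l \<and>
     inv b \<otimes> (a [^] (2::int) \<otimes> b) = a [^] (-2::int) \<otimes> z [^] int l"
    unfolding G2_relations_def Let_def word_comm_def word_conj_def z_def
    by (simp add: eval m_assoc flip: a_def b_def) (simp add: num neg)
  also have "\<dots> \<longleftrightarrow> G2_group G a b (2 ^ d) (int k) (int l)"
  proof -
    have "even (2 ^ d :: int) \<or> int k = 0 \<and> int l = 0"
      using d by auto
    then show ?thesis
      using d is_group by (simp add: G2_group_def G2_group_axioms_def solve m_assoc z_def)
  qed
  finally show ?thesis by (simp only: a_def b_def)
qed

end

text \<open>Apart from \<open>parity\<close>, which concerns integers only, the assumptions are
  membership and equations between products of powers, so they carry over to images.\<close>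

lemma G2_group_hom:
  assumes "G2_group G a b \<mu> k l" "\<sigma> \<in> hom G H" "group H"
  shows "G2_group H (\<sigma> a) (\<sigma> b) \<mu> k l"
proof -
  interpret G2_group G a b \<mu> k l by fact
  interpret H: group H by fact
  interpret group_hom G H \<sigma> using assms(2) by unfold_locales
  show ?thesis
    by unfold_locales
      (use parity in \<open>simp_all add: a_order b_order squares_commute comm conj_b2 conj_a2 m_assoc del: hom_mult hom_one flip: hom_mult hom_int_pow hom_one\<close>)
qed

text \<open>The first part makes the model a target for homomorphisms from the presented group; the
  second lets such a homomorphism read off both exponents of a normal form.\<close>

lemma G2_group_model:
  assumes "\<mu> > 0" and par: "even \<mu> \<or> k = 0 \<and> l = 0"
  shows "G2_group (G2_model \<mu> k l) (reduce (4 * \<mu>) (1, 0)) (reduce (4 * \<mu>) (0, 1)) \<mu> k l"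
    and "reduce (4 * \<mu>) (1, 0) [^]\<^bsub>G2_model \<mu> k l\<^esub> i \<otimes>\<^bsub>G2_model \<mu> k l\<^esub>
      reduce (4 * \<mu>) (0, 1) [^]\<^bsub>G2_model \<mu> k l\<^esub> j = reduce (4 * \<mu>) (i, j)"
proof -
  let ?M = "G2_model \<mu> k l" and ?r = "\<lambda>i j. reduce (4 * \<mu>) (i, j)"
  interpret group ?M using assms by (rule group_G2_model)
  have closed: "?r i j \<in> carrier ?M" for i j
    using assms(1) by (rule reduce_in_model)
  have one: "\<one>\<^bsub>?M\<^esub> = ?r 0 0" by (simp add: G2_model_def reduce_def)
  have mult: "?r i j \<otimes>\<^bsub>?M\<^esub> ?r f h =
      ?r (i + alt j f + 2 * \<mu> * twist k l j f) (alt f j + h + 2 * \<mu> * twist k l j f)" for i j f h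
    unfolding reduce_mult[OF par] by (simp add: model_op_def Let_def)
  have eqI: "?r i j = ?r i' j'"
    if "i = i' + 2 * \<mu> * s" "j = j' + 2 * \<mu> * t" "even s" "even t" for i j i' j' s t
    using that by (auto simp: reduce_eq_iff cong_pair_def cong_iff_dvd_diff elim!: evenE)
  have pow: "?r 1 0 [^]\<^bsub>?M\<^esub> i = ?r i 0" "?r 0 1 [^]\<^bsub>?M\<^esub> i = ?r 0 i" for i :: int
    by (rule int_pow_eqI; simp add: closed one mult alt_def twist_def)+
  have z_pow: "?r (2 * \<mu>) (2 * \<mu>) [^]\<^bsub>?M\<^esub> i = ?r (2 * \<mu> * i) (2 * \<mu> * i)" for i :: int
    by (rule int_pow_eqI; simp add: closed one mult alt_def twist_def distrib_left)
  show "?r 1 0 [^]\<^bsub>?M\<^esub> i \<otimes>\<^bsub>?M\<^esub> ?r 0 1 [^]\<^bsub>?M\<^esub> j = ?r i j"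
    by (simp add: pow mult alt_def twist_def)
  have z: "?r 1 0 [^]\<^bsub>?M\<^esub> (2 * \<mu>) \<otimes>\<^bsub>?M\<^esub> ?r 0 1 [^]\<^bsub>?M\<^esub> (2 * \<mu>) = ?r (2 * \<mu>) (2 * \<mu>)"
    by (simp add: pow mult alt_def twist_def)
  have div: "(2 + 2 * \<mu> * k) div 2 = 1 + \<mu> * k" "(- 2 + 2 * \<mu> * l) div 2 = -1 + \<mu> * l"
    by (simp_all add: algebra_simps)
  show "G2_group ?M (?r 1 0) (?r 0 1) \<mu> k l"
  proof unfold_locales
    show "?r 1 0 [^]\<^bsub>?M\<^esub> (4 * \<mu>) = \<one>\<^bsub>?M\<^esub>"
      unfolding pow one by (rule eqI[where s = 2 and t = 0]) simp_all
    show "?r 0 1 [^]\<^bsub>?M\<^esub> (4 * \<mu>) = \<one>\<^bsub>?M\<^esub>"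
      unfolding pow one by (rule eqI[where s = 0 and t = 2]) simp_all
    show "?r 0 1 [^]\<^bsub>?M\<^esub> (2::int) \<otimes>\<^bsub>?M\<^esub> ?r 1 0 [^]\<^bsub>?M\<^esub> (2::int) =
        ?r 1 0 [^]\<^bsub>?M\<^esub> (2::int) \<otimes>\<^bsub>?M\<^esub> ?r 0 1 [^]\<^bsub>?M\<^esub> (2::int)"
      by (simp add: pow mult alt_def twist_def)
    show "?r 0 1 \<otimes>\<^bsub>?M\<^esub> ?r 1 0 = ?r 1 0 \<otimes>\<^bsub>?M\<^esub> ?r 0 1 \<otimes>\<^bsub>?M\<^esub>
        (?r 1 0 [^]\<^bsub>?M\<^esub> (2::int) \<otimes>\<^bsub>?M\<^esub> ?r 0 1 [^]\<^bsub>?M\<^esub> (- 2 :: int) \<otimes>\<^bsub>?M\<^esub>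
         (?r 1 0 [^]\<^bsub>?M\<^esub> (2 * \<mu>) \<otimes>\<^bsub>?M\<^esub> ?r 0 1 [^]\<^bsub>?M\<^esub> (2 * \<mu>)) [^]\<^bsub>?M\<^esub> k)"
      unfolding z z_pow unfolding pow mult
      \<comment> \<open>The witnesses are the differences of the two coordinates divided by
        2\<open>\<mu>\<close>. They are even because l\<open>\<mu>\<close> is.\<close>
      by (rule eqI[where s = "2 * k - l * \<mu> * k" and t = "- l * \<mu> * k"];
          use par in \<open>auto simp: alt_def twist_def div algebra_simps\<close>)
    show "?r 0 1 [^]\<^bsub>?M\<^esub> (2::int) \<otimes>\<^bsub>?M\<^esub> ?r 1 0 = ?r 1 0 \<otimes>\<^bsub>?M\<^esub>
        (?r 0 1 [^]\<^bsub>?M\<^esub> (- 2 :: int) \<otimes>\<^bsub>?M\<^esub>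
         (?r 1 0 [^]\<^bsub>?M\<^esub> (2 * \<mu>) \<otimes>\<^bsub>?M\<^esub> ?r 0 1 [^]\<^bsub>?M\<^esub> (2 * \<mu>)) [^]\<^bsub>?M\<^esub> l)"
      unfolding z z_pow unfolding pow mult
      by (rule eqI[where s = 0 and t = 0]; simp add: alt_def twist_def)
    show "?r 1 0 [^]\<^bsub>?M\<^esub> (2::int) \<otimes>\<^bsub>?M\<^esub> ?r 0 1 = ?r 0 1 \<otimes>\<^bsub>?M\<^esub>
        (?r 1 0 [^]\<^bsub>?M\<^esub> (- 2 :: int) \<otimes>\<^bsub>?M\<^esub>
         (?r 1 0 [^]\<^bsub>?M\<^esub> (2 * \<mu>) \<otimes>\<^bsub>?M\<^esub> ?r 0 1 [^]\<^bsub>?M\<^esub> (2 * \<mu>)) [^]\<^bsub>?M\<^esub> l)"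
      unfolding z z_pow unfolding pow mult
      by (rule eqI[where s = "2 * l - l * \<mu> * l" and t = "- l * \<mu> * l"];
          use par in \<open>auto simp: alt_def twist_def div algebra_simps\<close>)
  qed (use par closed in auto)
qed

section \<open>The relations between two normal forms\<close>

context G2_group
begin

text \<open>Measures the period 4\<open>\<mu>\<close> in half-periods, the unit in which the
  corrections of \<open>P_mult\<close> appear.\<close>

lemma P_eqI:
  assumes "i = i' + 2 * \<mu> * s" "j = j' + 2 * \<mu> * t" "even s" "even t"
  shows "P i j = P i' j'"
  using assms by (intro P_cong) (auto simp: cong_iff_dvd_diff elim!: evenE)

lemma P_0: "P 0 0 = \<one>"
  by (simp add: P_def)

lemma P_mult_even:
  "P i j \<otimes> P (2 * f) (2 * h) =
     (if even j then P (i + 2 * f) (j + 2 * h)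
      else P (i - 2 * f + 2 * \<mu> * (l * f)) (j + 2 * h + 2 * \<mu> * (l * f)))"
  by (simp add: P_mult alt_def twist_def)

lemma even_P_mult:
  "P (2 * f) (2 * h) \<otimes> P i j =
     (if even i then P (2 * f + i) (2 * h + j)
      else P (2 * f + i + 2 * \<mu> * (l * h)) (- 2 * h + j + 2 * \<mu> * (l * h)))"
  by (simp add: P_mult alt_def twist_def)

lemma P_even_pow: "P (2 * \<alpha>) (2 * \<beta>) [^] u = P (2 * \<alpha> * u) (2 * \<beta> * u)" for u :: int
  unfolding P_def by (simp add: int_pow_mult_distrib even_powers_commute int_pow_pow)

lemma z_eq_P: "z = P (2 * \<mu>) (2 * \<mu>)"
  by (simp add: z_def P_def)

lemma z_pow_eq_P: "z [^] t = P (2 * (\<mu> * t)) (2 * (\<mu> * t))" for t :: int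
  by (simp add: z_pow P_def mult.assoc)

end

text \<open>
  Here \<open>z\<close> is the central element of the ambient group, so \<open>x\<close> and \<open>y\<close> satisfy the relations of
  \<open>G2_group\<close> with other parameters iff the corresponding powers of \<open>z\<close> agree.
\<close>

definition G2_rels_with :: "('a, 'm) monoid_scheme \<Rightarrow> 'a \<Rightarrow> int \<Rightarrow> int \<Rightarrow> int \<Rightarrow> 'a \<Rightarrow> 'a \<Rightarrow> bool" where
  "G2_rels_with G z \<mu> k l x y \<longleftrightarrow>
     x [^]\<^bsub>G\<^esub> (4 * \<mu>) = \<one>\<^bsub>G\<^esub> \<and> y [^]\<^bsub>G\<^esub> (4 * \<mu>) = \<one>\<^bsub>G\<^esub> \<and>
     y [^]\<^bsub>G\<^esub> (2::int) \<otimes>\<^bsub>G\<^esub> x [^]\<^bsub>G\<^esub> (2::int) = x [^]\<^bsub>G\<^esub> (2::int) \<otimes>\<^bsub>G\<^esub> y [^]\<^bsub>G\<^esub> (2::int) \<and>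
     x [^]\<^bsub>G\<^esub> (2 * \<mu>) \<otimes>\<^bsub>G\<^esub> y [^]\<^bsub>G\<^esub> (2 * \<mu>) = z \<and>
     y \<otimes>\<^bsub>G\<^esub> x = x \<otimes>\<^bsub>G\<^esub> y \<otimes>\<^bsub>G\<^esub> (x [^]\<^bsub>G\<^esub> (2::int) \<otimes>\<^bsub>G\<^esub> y [^]\<^bsub>G\<^esub> (-2::int) \<otimes>\<^bsub>G\<^esub> z [^]\<^bsub>G\<^esub> k) \<and>
     y [^]\<^bsub>G\<^esub> (2::int) \<otimes>\<^bsub>G\<^esub> x = x \<otimes>\<^bsub>G\<^esub> (y [^]\<^bsub>G\<^esub> (-2::int) \<otimes>\<^bsub>G\<^esub> z [^]\<^bsub>G\<^esub> l) \<and>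
     x [^]\<^bsub>G\<^esub> (2::int) \<otimes>\<^bsub>G\<^esub> y = y \<otimes>\<^bsub>G\<^esub> (x [^]\<^bsub>G\<^esub> (-2::int) \<otimes>\<^bsub>G\<^esub> z [^]\<^bsub>G\<^esub> l)"

definition good_parity :: "int \<Rightarrow> int \<Rightarrow> int \<Rightarrow> int \<Rightarrow> bool" where
  "good_parity i j f h \<longleftrightarrow>
     odd i \<and> odd h \<and> even j \<and> even f \<or> even i \<and> even h \<and> odd j \<and> odd f"

context G2_group
begin

lemma P_pow2: "P i j [^] (2::int) = P i j \<otimes> P i j"
  using int_pow_mult[of "P i j" 1 1] by simp

text \<open>Once the squares of x and y are normal forms with even exponents, all even powers of x
  and y commute and multiply coordinatewise. Each relation then becomes a comparison of
  exponents.\<close>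

lemma G2_rels_withI:
  assumes x: "x = P i j" and y: "y = P f h"
    and x2: "x [^] (2::int) = P (2 * \<alpha>) (2 * \<beta>)" and y2: "y [^] (2::int) = P (2 * \<alpha>') (2 * \<beta>')"
    and par: "odd (\<alpha> + \<alpha>')" "odd (\<beta> + \<beta>')"
    and comm: "y \<otimes> x = x \<otimes> y \<otimes> P (2 * (\<alpha> - \<alpha>' + \<mu> * t)) (2 * (\<beta> - \<beta>' + \<mu> * t))"
    and conj_y2: "P (2 * \<alpha>') (2 * \<beta>') \<otimes> x = x \<otimes> P (2 * (- \<alpha>' + \<mu> * l)) (2 * (- \<beta>' + \<mu> * l))"
    and conj_x2: "P (2 * \<alpha>) (2 * \<beta>) \<otimes> y = y \<otimes> P (2 * (- \<alpha> + \<mu> * l)) (2 * (- \<beta> + \<mu> * l))"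
  shows "G2_rels_with G z \<mu> t l x y"
proof -
  have cl [simp]: "x \<in> carrier G" "y \<in> carrier G" by (simp_all add: x y)
  have X: "x [^] (2 * u) = P (2 * (\<alpha> * u)) (2 * (\<beta> * u))" for u
    using P_even_pow[of \<alpha> \<beta> u] by (simp add: x2 mult.assoc flip: int_pow_pow)
  have Y: "y [^] (2 * u) = P (2 * (\<alpha>' * u)) (2 * (\<beta>' * u))" for u
    using P_even_pow[of \<alpha>' \<beta>' u] by (simp add: y2 mult.assoc flip: int_pow_pow)
  note m2 = X[of "- 1", simplified] Y[of "- 1", simplified]
  show ?thesis
    unfolding G2_rels_with_def
  proof (intro conjI)
    show "x [^] (4 * \<mu>) = \<one>"
      using X[of "2 * \<mu>"] P_eqI[of "2 * (\<alpha> * (2 * \<mu>))" 0 "2 * \<alpha>" "2 * (\<beta> * (2 * \<mu>))" 0 "2 * \<beta>"]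
      by (simp add: P_0)
    show "y [^] (4 * \<mu>) = \<one>"
      using Y[of "2 * \<mu>"] P_eqI[of "2 * (\<alpha>' * (2 * \<mu>))" 0 "2 * \<alpha>'" "2 * (\<beta>' * (2 * \<mu>))" 0 "2 * \<beta>'"]
      by (simp add: P_0)
    show "y [^] (2::int) \<otimes> x [^] (2::int) = x [^] (2::int) \<otimes> y [^] (2::int)"
      by (simp add: x2 y2 P_mult_even add.commute)
    show "x [^] (2 * \<mu>) \<otimes> y [^] (2 * \<mu>) = z"
      \<comment> \<open>The exponents are 2\<open>\<mu>\<close> times the two odd sums, hence
        congruent to 2\<open>\<mu>\<close> modulo 4\<open>\<mu>\<close>.\<close>
      unfolding X Y z_eq_P P_mult_even
      using P_eqI[of "2 * (\<alpha> * \<mu>) + 2 * (\<alpha>' * \<mu>)" "2 * \<mu>" "\<alpha> + \<alpha>' - 1"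
          "2 * (\<beta> * \<mu>) + 2 * (\<beta>' * \<mu>)" "2 * \<mu>" "\<beta> + \<beta>' - 1"] par
      by (simp add: algebra_simps)
    show "y \<otimes> x = x \<otimes> y \<otimes> (x [^] (2::int) \<otimes> y [^] (-2::int) \<otimes> z [^] t)"
      unfolding comm m2 x2 z_pow_eq_P
      using P_mult_even[of "2 * \<alpha>" "2 * \<beta>" "- \<alpha>'" "- \<beta>'"]
        P_mult_even[of "2 * \<alpha> - 2 * \<alpha>'" "2 * \<beta> - 2 * \<beta>'" "\<mu> * t" "\<mu> * t"]
      by (simp add: right_diff_distrib distrib_left)
    show "y [^] (2::int) \<otimes> x = x \<otimes> (y [^] (-2::int) \<otimes> z [^] l)"
      unfolding m2 y2 z_pow_eq_P conj_y2
      using P_mult_even[of "- 2 * \<alpha>'" "- 2 * \<beta>'" "\<mu> * l" "\<mu> * l"]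
      by (simp add: right_diff_distrib distrib_left)
    show "x [^] (2::int) \<otimes> y = y \<otimes> (x [^] (-2::int) \<otimes> z [^] l)"
      unfolding m2 x2 z_pow_eq_P conj_x2
      using P_mult_even[of "- 2 * \<alpha>" "- 2 * \<beta>" "\<mu> * l" "\<mu> * l"]
      by (simp add: right_diff_distrib distrib_left)
  qed
qed

text \<open>The change from k to t combines the twist met when x and y are exchanged with the powers
  of z contained in their squares.\<close>

lemma good_rels:
  assumes good: "good_parity i j f h"
  defines "t \<equiv> k + l * (f + h - i - j) div 2"
  shows "G2_rels_with G z \<mu> t l (P i j) (P f h)"
  using good unfolding good_parity_def
proof
  assume "odd i \<and> odd h \<and> even j \<and> even f"
  then obtain i' j' f' h' where ijfh: "i = 2 * i' + 1" "j = 2 * j'" "f = 2 * f'" "h = 2 * h' + 1"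
    by (auto elim!: evenE oddE)
  \<comment> \<open>Half the exponents of the squares: x^2 is a^(2i) z^(l j') and y^2 is b^(2h) z^(l
    f').\<close>
  define \<alpha> \<beta> \<alpha>' \<beta>' where defs: "\<alpha> = i + \<mu> * l * j'" "\<beta> = \<mu> * l * j'" "\<alpha>' = \<mu> * l * f'" "\<beta>' = h + \<mu> * l * f'"
  have t: "t = k + l * (f' + h' - i' - j')"
    unfolding t_def ijfh by (simp add: algebra_simps)
  have par: "odd \<alpha>" "even \<beta>" "even \<alpha>'" "odd \<beta>'"
    using parity by (auto simp: defs ijfh)
  have tw: "twist k l h i = k + l * (h' + i' + 1)"
    by (simp add: twist_def ijfh algebra_simps)
  have yx: "P f h \<otimes> P i j = P (f + - i + 2 * \<mu> * (k + l * (h' + i' + 1))) (- h + j + 2 * \<mu> * (k + l * (h' + i' + 1)))"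
    by (simp only: P_mult tw) (simp add: alt_def ijfh)
  have xy: "P i j \<otimes> P f h = P (i + f) (j + h)"
    by (simp add: P_mult alt_def twist_def ijfh)
  show ?thesis
  proof (rule G2_rels_withI[OF HOL.refl HOL.refl])
    show "P i j [^] (2::int) = P (2 * \<alpha>) (2 * \<beta>)"
      by (simp add: P_pow2 P_mult) (simp add: alt_def twist_def defs ijfh algebra_simps)
    show "P f h [^] (2::int) = P (2 * \<alpha>') (2 * \<beta>')"
      by (simp add: P_pow2 P_mult) (simp add: alt_def twist_def defs ijfh algebra_simps)
    show "odd (\<alpha> + \<alpha>')" "odd (\<beta> + \<beta>')" using par by auto
    let ?A = "\<alpha> - \<alpha>' + \<mu> * t"
    have "odd (j + h)" by (simp add: ijfh)
    then show "P f h \<otimes> P i j = P i j \<otimes> P f h \<otimes> P (2 * ?A) (2 * (\<beta> - \<beta>' + \<mu> * t))"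
      unfolding yx xy P_mult_even
      apply simp
      \<comment> \<open>The coordinate differences divided by 2\<open>\<mu>\<close>. After
        substituting t they are l(1 - \<open>?A\<close>) plus an even number, and \<open>?A\<close>
        is odd.\<close>
      apply (rule P_eqI[where s = "k + l * (h' + i' + 1) + l * (j' - f') + t - l * ?A"
            and t = "k + l * (h' + i' + 1) - l * (j' - f') - t - l * ?A"])
      using parity par by (auto simp: t) (auto simp: defs algebra_simps)
    show "P (2 * \<alpha>') (2 * \<beta>') \<otimes> P i j = P i j \<otimes> P (2 * (- \<alpha>' + \<mu> * l)) (2 * (- \<beta>' + \<mu> * l))"
      unfolding even_P_mult P_mult_even using par
      by (simp add: ijfh) (rule P_eqI[where s = "2 * l * f' + l * (\<beta>' - 1)" and t = "l * (\<beta>' - 1)"];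
         auto simp: defs(3) algebra_simps)
    show "P (2 * \<alpha>) (2 * \<beta>) \<otimes> P f h = P f h \<otimes> P (2 * (- \<alpha> + \<mu> * l)) (2 * (- \<beta> + \<mu> * l))"
      unfolding even_P_mult P_mult_even using par parity
      by (simp add: ijfh) (rule P_eqI[where s = "l + l * \<alpha> - l * (\<mu> * l)" and t = "2 * l * j' - l - l * (- \<alpha> + \<mu> * l)"];
         auto simp: defs(2) algebra_simps)
  qed
next
  \<comment> \<open>Now x resembles b and y resembles a, so the twist arises in xy rather than in
    yx.\<close>
  assume "even i \<and> even h \<and> odd j \<and> odd f"
  then obtain i' j' f' h' where ijfh: "i = 2 * i'" "j = 2 * j' + 1" "f = 2 * f' + 1" "h = 2 * h'"
    by (auto elim!: evenE oddE)
  define \<alpha> \<beta> \<alpha>' \<beta>' where defs: "\<alpha> = \<mu> * l * i'" "\<beta> = j + \<mu> * l * i'" "\<alpha>' = f + \<mu> * l * h'" "\<beta>' = \<mu> * l * h'"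
  have t: "t = k + l * (f' + h' - i' - j')"
    unfolding t_def ijfh by (simp add: algebra_simps)
  have par: "even \<alpha>" "odd \<beta>" "odd \<alpha>'" "even \<beta>'"
    using parity by (auto simp: defs ijfh)
  have tw: "twist k l j f = k + l * (j' + f' + 1)"
    by (simp add: twist_def ijfh algebra_simps)
  let ?K = "k + l * (j' + f' + 1)"
  have yx: "P f h \<otimes> P i j = P (f + i) (h + j)"
    by (simp add: P_mult alt_def twist_def ijfh)
  have xy: "P i j \<otimes> P f h = P (i + - f + 2 * \<mu> * ?K) (- j + h + 2 * \<mu> * ?K)"
    by (simp only: P_mult tw) (simp add: alt_def ijfh)
  show ?thesis
  proof (rule G2_rels_withI[OF HOL.refl HOL.refl])
    show "P i j [^] (2::int) = P (2 * \<alpha>) (2 * \<beta>)"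
      by (simp add: P_pow2 P_mult) (simp add: alt_def twist_def defs ijfh algebra_simps)
    show "P f h [^] (2::int) = P (2 * \<alpha>') (2 * \<beta>')"
      by (simp add: P_pow2 P_mult) (simp add: alt_def twist_def defs ijfh algebra_simps)
    show "odd (\<alpha> + \<alpha>')" "odd (\<beta> + \<beta>')" using par by auto
    let ?A = "\<alpha> - \<alpha>' + \<mu> * t"
    have "odd (- j + h + 2 * \<mu> * ?K)" by (simp add: ijfh)
    then show "P f h \<otimes> P i j = P i j \<otimes> P f h \<otimes> P (2 * ?A) (2 * (\<beta> - \<beta>' + \<mu> * t))"
      unfolding yx xy P_mult_even
      apply simp
      apply (rule P_eqI[where s = "l * (i' - h') + t - ?K - l * ?A" and t = "- ?K - l * (i' - h') - t - l * ?A"])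
      using parity par by (auto simp: t) (auto simp: defs algebra_simps)
    show "P (2 * \<alpha>') (2 * \<beta>') \<otimes> P i j = P i j \<otimes> P (2 * (- \<alpha>' + \<mu> * l)) (2 * (- \<beta>' + \<mu> * l))"
      unfolding even_P_mult P_mult_even using par parity
      by (simp add: ijfh) (rule P_eqI[where s = "l - l * (- \<alpha>' + \<mu> * l) + 0" and t = "2 * l * h' - l - l * (- \<alpha>' + \<mu> * l)"];
         auto simp: defs(4) algebra_simps)
    show "P (2 * \<alpha>) (2 * \<beta>) \<otimes> P f h = P f h \<otimes> P (2 * (- \<alpha> + \<mu> * l)) (2 * (- \<beta> + \<mu> * l))"
      unfolding even_P_mult P_mult_even using par
      by (simp add: ijfh) (rule P_eqI[where s = "2 * l * i' + l * (\<beta> - 1)" and t = "l * (\<beta> - 1)"];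
         auto simp: defs(1) algebra_simps)
  qed
qed

end

section \<open>Groups in which normal forms are unique\<close>

text \<open>Normal forms exist and are unique modulo 4\<open>\<mu>\<close>, so the order is known, z
  has order exactly two, and parities of exponents are well defined. That \<open>\<mu>\<close> is a
  power of two makes odd exponents invertible modulo 4\<open>\<mu>\<close>.\<close>

locale G2_free = G2_group +
  fixes d :: nat
  assumes mu: "\<mu> = 2 ^ d"
    and exhaust: "g \<in> carrier G \<Longrightarrow> \<exists>i j. g = P i j"
    and P_inj: "P i j = P i' j' \<Longrightarrow> [i = i'] (mod (4 * \<mu>)) \<and> [j = j'] (mod (4 * \<mu>))"
begin

lemma mu_pos: "\<mu> > 0"
  by (simp add: mu)

lemma P_inj_parity:
  assumes "P i j = P i' j'"
  shows "even i \<longleftrightarrow> even i'" "even j \<longleftrightarrow> even j'"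
  using P_inj[OF assms] by (auto dest!: cong_imp_shift)

lemma z_pow_eq_iff: "z [^] s = z [^] t \<longleftrightarrow> even (s - t)" for s t :: int
proof
  assume "z [^] s = z [^] t"
  then obtain w where "2 * (\<mu> * s) = 2 * (\<mu> * t) + 4 * \<mu> * w"
    unfolding z_pow_eq_P by (auto dest!: P_inj cong_imp_shift)
  then have "\<mu> * s = \<mu> * (t + 2 * w)" by (simp add: distrib_left)
  then show "even (s - t)" using mu_pos by simp
next
  assume "even (s - t)"
  then obtain w where w: "s = t + 2 * w" by (blast dest: even_diff_imp)
  show "z [^] s = z [^] t"
    unfolding z_pow_eq_P by (rule P_eqI[where s = "2 * w" and t = "2 * w"]) (simp_all add: w algebra_simps)
qed

lemma card_carrier: "finite (carrier G)" "card (carrier G) = nat (4 * \<mu>) * nat (4 * \<mu>)"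
proof -
  let ?B = "{0..<4 * \<mu>} \<times> {0..<4 * \<mu>}"
  have "inj_on (\<lambda>(i, j). P i j) ?B"
    by (rule inj_onI) (auto dest!: P_inj simp: cong_def)
  moreover have "(\<lambda>(i, j). P i j) ` ?B = carrier G"
  proof (intro equalityI subsetI)
    fix g assume "g \<in> carrier G"
    then obtain i j where "g = P i j" using exhaust by blast
    also have "\<dots> = P (i mod (4 * \<mu>)) (j mod (4 * \<mu>))"
      by (rule P_cong) (simp_all add: cong_def)
    finally show "g \<in> (\<lambda>(i, j). P i j) ` ?B"
      using mu_pos by (intro image_eqI[where x = "(i mod (4 * \<mu>), j mod (4 * \<mu>))"]) auto
  qed auto
  ultimately have "bij_betw (\<lambda>(i, j). P i j) ?B (carrier G)"
    by (simp add: bij_betw_def)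
  then show "finite (carrier G)" "card (carrier G) = nat (4 * \<mu>) * nat (4 * \<mu>)"
    by (auto dest: bij_betw_finite bij_betw_same_card)
qed

section \<open>Homomorphisms, generating pairs and their parities\<close>

lemma hom_determined:
  assumes "group H" "\<sigma> \<in> hom G H" "\<tau> \<in> hom G H" "\<sigma> a = \<tau> a" "\<sigma> b = \<tau> b" "g \<in> carrier G"
  shows "\<sigma> g = \<tau> g"
proof -
  interpret H: group H by fact
  interpret \<sigma>: group_hom G H \<sigma> using assms by unfold_locales
  interpret \<tau>: group_hom G H \<tau> using assms by unfold_locales
  obtain i j :: int where "g = a [^] i \<otimes> b [^] j"
    using exhaust[OF assms(6)] unfolding P_def by blast
  then show ?thesis
    by (simp add: assms(4,5) \<sigma>.hom_int_pow \<tau>.hom_int_pow)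
qed

text \<open>As q is coprime to 4\<open>\<mu>\<close> = 2^(d + 2), Bezout's identity makes g a power
  of g^q.\<close>

lemma odd_root_in_subgroup:
  assumes K: "subgroup K G" and g: "g \<in> carrier G" "g [^] (4 * \<mu>) = \<one>" and q: "odd (q :: int)" "g [^] q \<in> K"
  shows "g \<in> K"
proof -
  have "coprime q (2 ^ (d + 2))" using q(1) by (metis coprime_power_right_iff coprime_right_2_iff_odd)
  then obtain r s where rs: "q * r + 2 ^ (d + 2) * s = 1"
    by (metis bezout_int coprime_imp_gcd_eq_1 mult.commute)
  have "g = g [^] (q * r + 4 * \<mu> * s)"
    using rs g(1) by (simp add: mu power_add mult.commute)
  also have "\<dots> = (g [^] q) [^] r"
    using g by (simp add: int_pow_mult flip: int_pow_pow)
  also have "\<dots> \<in> K" using K q(2) by (rule subgroup_int_pow_closed)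
  finally show ?thesis .
qed

text \<open>K contains z, the product of the powers 2\<open>\<mu>\<close> of the two elements. Their
  squares are, up to z, odd powers of a^2 and b^2, so a^2 and b^2 lie in K. Stripping the even
  powers from the two elements leaves odd powers of a and b.\<close>

lemma good_generate:
  assumes good: "good_parity i j f h" and K: "subgroup K G" "P i j \<in> K" "P f h \<in> K"
  shows "K = carrier G"
proof -
  interpret K: subgroup K G by fact
  have pow: "g [^] u \<in> K" if "g \<in> K" for g and u :: int
    using K(1) that by (rule subgroup_int_pow_closed)
  have cancel_right: "u \<in> K" if "u \<otimes> v \<in> K" "v \<in> K" "u \<in> carrier G" for u v
  proof -
    have "u = u \<otimes> v \<otimes> inv v" using that K.mem_carrier by (simp add: m_assoc)
    then show ?thesis using that K.m_closed K.m_inv_closed by metis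
  qed
  have cancel_left: "v \<in> K" if "u \<otimes> v \<in> K" "u \<in> K" "v \<in> carrier G" for u v
  proof -
    have "v = inv u \<otimes> (u \<otimes> v)" using that K.mem_carrier by (simp flip: m_assoc)
    then show ?thesis using that K.m_closed K.m_inv_closed by metis
  qed
  have "z \<in> K"
    using good_rels[OF good] K.m_closed[OF pow[OF K(2)] pow[OF K(3)]]
    unfolding G2_rels_with_def by metis
  have sq: "(a [^] (2::int)) [^] (4 * \<mu>) = \<one>" "(b [^] (2::int)) [^] (4 * \<mu>) = \<one>"
    using a_period[of 0 2] b_period[of 0 2] by (simp_all add: int_pow_pow mult.commute)
  have even_a: "a [^] (2 * u) \<in> K" if "a [^] (2::int) \<in> K" for u :: int
    using pow[OF that, of u] by (simp add: int_pow_pow)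
  have even_b: "b [^] (2 * u) \<in> K" if "b [^] (2::int) \<in> K" for u :: int
    using pow[OF that, of u] by (simp add: int_pow_pow)
  have a_sq: "a [^] (2::int) \<in> K" if "P (2 * q) 0 \<otimes> z [^] t \<in> K" "odd q" for q t :: int
  proof -
    have "P (2 * q) 0 \<in> K" using cancel_right[OF that(1)] pow[OF \<open>z \<in> K\<close>, of t] by simp
    then show ?thesis
      using odd_root_in_subgroup[OF K(1) _ sq(1) that(2)] by (simp add: P_def int_pow_pow)
  qed
  have b_sq: "b [^] (2::int) \<in> K" if "P 0 (2 * q) \<otimes> z [^] t \<in> K" "odd q" for q t :: int
  proof -
    have "P 0 (2 * q) \<in> K" using cancel_right[OF that(1)] pow[OF \<open>z \<in> K\<close>, of t] by simp
    then show ?thesis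
      using odd_root_in_subgroup[OF K(1) _ sq(2) that(2)] by (simp add: P_def int_pow_pow)
  qed
  have P_square: "P (2 * u) 0 \<otimes> z [^] t = P (2 * u + 2 * (\<mu> * t)) (2 * (\<mu> * t))"
    "P 0 (2 * u) \<otimes> z [^] t = P (2 * (\<mu> * t)) (2 * u + 2 * (\<mu> * t))" for u t :: int
    unfolding z_pow_eq_P P_mult_even by simp_all
  have sqK: "P i j \<otimes> P i j \<in> K" "P f h \<otimes> P f h \<in> K"
    using K by auto
  have "a \<in> K \<and> b \<in> K"
    using good unfolding good_parity_def
  proof
    assume p: "odd i \<and> odd h \<and> even j \<and> even f"
    then obtain j' f' where jf: "j = 2 * j'" "f = 2 * f'" by (auto elim!: evenE)
    have "P i j \<otimes> P i j = P (2 * i) 0 \<otimes> z [^] (l * j')"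
      unfolding P_square using p by (simp add: P_mult alt_def twist_def jf mult.assoc)
    with sqK a_sq p have a2: "a [^] (2::int) \<in> K" by metis
    have "P f h \<otimes> P f h = P 0 (2 * h) \<otimes> z [^] (l * f')"
      unfolding P_square using p by (simp add: P_mult alt_def twist_def jf mult.assoc)
    with sqK b_sq p have b2: "b [^] (2::int) \<in> K" by metis
    have "a [^] i \<in> K"
      using cancel_right[of "a [^] i" "b [^] j"] K(2) even_b[OF b2, of j'] by (simp add: P_def jf)
    moreover have "b [^] h \<in> K"
      using cancel_left[of "a [^] f" "b [^] h"] K(3) even_a[OF a2, of f'] by (simp add: P_def jf)
    ultimately show ?thesis
      using odd_root_in_subgroup[OF K(1)] a_order b_order p by blast
  next
    assume p: "even i \<and> even h \<and> odd j \<and> odd f"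
    then obtain i' h' where ih: "i = 2 * i'" "h = 2 * h'" by (auto elim!: evenE)
    have "P i j \<otimes> P i j = P 0 (2 * j) \<otimes> z [^] (l * i')"
      unfolding P_square using p by (simp add: P_mult alt_def twist_def ih mult.assoc)
    with sqK b_sq p have b2: "b [^] (2::int) \<in> K" by metis
    have "P f h \<otimes> P f h = P (2 * f) 0 \<otimes> z [^] (l * h')"
      unfolding P_square using p by (simp add: P_mult alt_def twist_def ih mult.assoc)
    with sqK a_sq p have a2: "a [^] (2::int) \<in> K" by metis
    have "b [^] j \<in> K"
      using cancel_left[of "a [^] i" "b [^] j"] K(2) even_a[OF a2, of i'] by (simp add: P_def ih)
    moreover have "a [^] f \<in> K"
      using cancel_right[of "a [^] f" "b [^] h"] K(3) even_b[OF b2, of h'] by (simp add: P_def ih)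
    ultimately show ?thesis
      using odd_root_in_subgroup[OF K(1)] a_order b_order p by blast
  qed
  then have "P u v \<in> K" for u v
    unfolding P_def by (intro K.m_closed pow) auto
  then show ?thesis using exhaust K.subset by blast
qed

text \<open>Modulo 2 signs and corrections vanish, so exponents add and the parity pair is a
  homomorphism to (Z/2)^2. The set is the kernel of a linear functional composed with it.\<close>

lemma parity_subgroup: "subgroup {P u v |u v. even (\<alpha> * u + \<beta> * v)} G"
proof (rule subgroupI)
  fix x assume "x \<in> {P u v |u v. even (\<alpha> * u + \<beta> * v)}"
  then obtain u v where x: "x = P u v" "even (\<alpha> * u + \<beta> * v)" by blast
  obtain u' v' where inv: "inv x = P u' v'" using exhaust x(1) by (metis P_closed inv_closed)
  have "P u' v' \<otimes> P u v = P 0 0"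
    unfolding P_0 by (metis inv x(1) P_closed l_inv)
  from P_inj_parity[OF this[unfolded P_mult]] have "even u' = even u" "even v' = even v"
    by (auto simp: alt_def split: if_splits)
  with x(2) show "inv x \<in> {P u v |u v. even (\<alpha> * u + \<beta> * v)}"
    unfolding inv by auto
next
  fix x y assume "x \<in> {P u v |u v. even (\<alpha> * u + \<beta> * v)}" "y \<in> {P u v |u v. even (\<alpha> * u + \<beta> * v)}"
  then obtain u v u' v' where xy: "x = P u v" "even (\<alpha> * u + \<beta> * v)" "y = P u' v'" "even (\<alpha> * u' + \<beta> * v')"
    by blast
  let ?u = "u + alt v u' + 2 * \<mu> * twist k l v u'" and ?v = "alt u' v + v' + 2 * \<mu> * twist k l v u'"
  have "even (\<alpha> * ?u + \<beta> * ?v)"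
    using xy(2,4) by (auto simp: alt_def)
  then show "x \<otimes> y \<in> {P u v |u v. even (\<alpha> * u + \<beta> * v)}"
    unfolding xy(1,3) P_mult by blast
qed (use P_0 in \<open>auto intro: exI[where x = 0]\<close>)

text \<open>A functional on (Z/2)^2 that vanishes on the parities of a generating pair vanishes
  everywhere.\<close>

lemma generate_imp_independent:
  assumes gen: "\<And>K. subgroup K G \<Longrightarrow> P i j \<in> K \<Longrightarrow> P f h \<in> K \<Longrightarrow> K = carrier G"
    and "even (\<alpha> * i + \<beta> * j)" "even (\<alpha> * f + \<beta> * h)"
  shows "even \<alpha> \<and> even \<beta>"
proof -
  let ?K = "{P u v |u v. even (\<alpha> * u + \<beta> * v)}"
  have K: "?K = carrier G"
    by (rule gen[OF parity_subgroup]) (use assms in blast)+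
  have "even (\<alpha> * u + \<beta> * v)" for u v
  proof -
    have "P u v \<in> ?K" unfolding K by simp
    then obtain u' v' where "P u v = P u' v'" "even (\<alpha> * u' + \<beta> * v')" by blast
    with P_inj_parity[of u v u' v'] show ?thesis by simp
  qed
  from this[of 1 0] this[of 0 1] show ?thesis by simp
qed

text \<open>With both exponents odd, the sign changes cancel everything in the square but z^c, and
  c\<open>\<mu>\<close> is even.\<close>

lemma odd_odd_pow:
  assumes "odd i" "odd j"
  shows "P i j [^] (2 * \<mu>) = \<one>"
proof -
  let ?c = "twist k l j i"
  have "P i j [^] (2::int) = z [^] ?c"
    using assms by (simp add: P_pow2 P_mult z_pow_eq_P alt_def mult.assoc)
  then have "P i j [^] (2 * \<mu>) = z [^] (?c * \<mu>)"
    by (simp flip: int_pow_pow)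
  also have "even (?c * \<mu>)"
    using parity by (auto simp: twist_def)
  then have "z [^] (?c * \<mu>) = \<one>" by (rule z_pow_even)
  finally show ?thesis .
qed

lemma generate_imp_good_parity:
  assumes gen: "\<And>K. subgroup K G \<Longrightarrow> P i j \<in> K \<Longrightarrow> P f h \<in> K \<Longrightarrow> K = carrier G"
    and "P i j [^] (2 * \<mu>) \<noteq> \<one>" "P f h [^] (2 * \<mu>) \<noteq> \<one>"
  shows "good_parity i j f h"
proof -
  have "even i \<or> even j" "even f \<or> even h"
    using assms(2,3) odd_odd_pow by blast+
  moreover have "even \<alpha> \<and> even \<beta>"
    if "even (\<alpha> * i + \<beta> * j)" "even (\<alpha> * f + \<beta> * h)" for \<alpha> \<beta>
    using gen that by (rule generate_imp_independent)
  \<comment> \<open>These are the three nonzero functionals on (Z/2)^2. With (1, 1) excluded for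
    both pairs, they leave only (1, 0) and (0, 1), in either order.\<close>
  from this[of 1 0] this[of 0 1] this[of 1 1]
  have "odd i \<or> odd f" "odd j \<or> odd h" "odd (i + j) \<or> odd (f + h)" by auto
  ultimately show ?thesis unfolding good_parity_def by auto
qed

text \<open>By \<open>good_rels\<close> the pair satisfies the relations with exponents t and l of
  the same z. Cancelling common factors reduces the relations for k1 and l1 to equalities of powers
  of z.\<close>

lemma good_G2_group_iff:
  assumes good: "good_parity i j f h"
  shows "G2_group G (P i j) (P f h) \<mu> k1 l1 \<longleftrightarrow>
    (even \<mu> \<or> k1 = 0 \<and> l1 = 0) \<and> even (l1 - l) \<and> even (k1 - (k + l * (f + h - i - j) div 2))"
proof -
  let ?x = "P i j" and ?y = "P f h" and ?t = "k + l * (f + h - i - j) div 2"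
  have rels:
    "?x [^] (4 * \<mu>) = \<one>" "?y [^] (4 * \<mu>) = \<one>"
    "?y [^] (2::int) \<otimes> ?x [^] (2::int) = ?x [^] (2::int) \<otimes> ?y [^] (2::int)"
    "?x [^] (2 * \<mu>) \<otimes> ?y [^] (2 * \<mu>) = z"
    "?y \<otimes> ?x = ?x \<otimes> ?y \<otimes> (?x [^] (2::int) \<otimes> ?y [^] (-2::int) \<otimes> z [^] ?t)"
    "?y [^] (2::int) \<otimes> ?x = ?x \<otimes> (?y [^] (-2::int) \<otimes> z [^] l)"
    "?x [^] (2::int) \<otimes> ?y = ?y \<otimes> (?x [^] (-2::int) \<otimes> z [^] l)"
    using good_rels[OF good] unfolding G2_rels_with_def by blast+
  have "G2_group G ?x ?y \<mu> k1 l1 \<longleftrightarrow>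
     (even \<mu> \<or> k1 = 0 \<and> l1 = 0) \<and> z [^] ?t = z [^] k1 \<and> z [^] l = z [^] l1"
    unfolding G2_group_def G2_group_axioms_def rels using is_group by auto
  then show ?thesis
    unfolding z_pow_eq_iff by auto
qed

end

section \<open>Isomorphisms\<close>

locale G2_free_pair = G2_free G a b \<mu> k l d + G1: G2_free G\<^sub>1 a\<^sub>1 b\<^sub>1 \<mu> k\<^sub>1 l\<^sub>1 d
  for G (structure) and a b \<mu> k l d and G\<^sub>1 (structure) and a\<^sub>1 b\<^sub>1 k\<^sub>1 l\<^sub>1
begin

lemma hom_G1_P:
  assumes "\<sigma> \<in> hom G\<^sub>1 G"
  shows "\<sigma> (G1.P i j) = \<sigma> a\<^sub>1 [^] i \<otimes> \<sigma> b\<^sub>1 [^] j"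
proof -
  interpret \<sigma>: group_hom G\<^sub>1 G \<sigma> using assms by unfold_locales
  show ?thesis by (simp add: G1.P_def \<sigma>.hom_int_pow)
qed

text \<open>Surjectivity makes the images of the generators generate, and injectivity keeps their
  powers 2\<open>\<mu>\<close> nontrivial; together these force the parities. The transported
  relations then give the congruences.\<close>

lemma iso_imp_params:
  assumes \<sigma>: "\<sigma> \<in> iso G\<^sub>1 G"
  obtains i j f h where "\<sigma> a\<^sub>1 = P i j" "\<sigma> b\<^sub>1 = P f h" "good_parity i j f h"
    "even (l\<^sub>1 - l)" "even (k\<^sub>1 - (k + l * (f + h - i - j) div 2))"
proof -
  have hom: "\<sigma> \<in> hom G\<^sub>1 G" and inj: "inj_on \<sigma> (carrier G\<^sub>1)" and surj: "\<sigma> ` carrier G\<^sub>1 = carrier G"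
    using \<sigma> by (auto simp: iso_def bij_betw_def)
  interpret \<sigma>: group_hom G\<^sub>1 G \<sigma> using hom by unfold_locales
  obtain i j where x: "\<sigma> a\<^sub>1 = P i j" using exhaust[of "\<sigma> a\<^sub>1"] by auto
  obtain f h where y: "\<sigma> b\<^sub>1 = P f h" using exhaust[of "\<sigma> b\<^sub>1"] by auto
  have gen: "K = carrier G" if K: "subgroup K G" "P i j \<in> K" "P f h \<in> K" for K
  proof -
    interpret K: subgroup K G by fact
    have "\<sigma> g \<in> K" if "g \<in> carrier G\<^sub>1" for g
    proof -
      obtain u v where "g = G1.P u v" using G1.exhaust \<open>g \<in> carrier G\<^sub>1\<close> by blast
      then have "\<sigma> g = P i j [^] u \<otimes> P f h [^] v" by (simp add: hom_G1_P[OF hom] x y)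
      then show ?thesis using K subgroup_int_pow_closed K.m_closed by metis
    qed
    then have "carrier G \<subseteq> K" unfolding surj[symmetric] by (rule image_subsetI)
    then show ?thesis using K.subset by (intro subset_antisym)
  qed
  have order: "\<sigma> (G1.P u v) [^] (2 * \<mu>) \<noteq> \<one>"
    if "G1.P u v [^]\<^bsub>G\<^sub>1\<^esub> (2 * \<mu>) = G1.P s t" "\<not> (4 * \<mu> dvd s \<and> 4 * \<mu> dvd t)" for u v s t
  proof
    assume "\<sigma> (G1.P u v) [^] (2 * \<mu>) = \<one>"
    then have "\<sigma> (G1.P u v [^]\<^bsub>G\<^sub>1\<^esub> (2 * \<mu>)) = \<sigma> (G1.P 0 0)"
      by (simp only: \<sigma>.hom_int_pow[OF G1.P_closed] G1.P_0 \<sigma>.hom_one)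
    then have "G1.P s t = G1.P 0 0"
      unfolding that(1) by (rule inj_onD[OF inj _ G1.P_closed G1.P_closed])
    then show False
      using G1.P_inj that(2) cong_0_iff by blast
  qed
  have not_dvd: "\<not> 4 * \<mu> dvd 2 * \<mu>"
    using zdvd_imp_le[of "4 * \<mu>" "2 * \<mu>"] mu_pos by linarith
  have "P i j [^] (2 * \<mu>) \<noteq> \<one>" "P f h [^] (2 * \<mu>) \<noteq> \<one>"
    using order[of 1 0 "2 * \<mu>" 0] order[of 0 1 0 "2 * \<mu>"] not_dvd
    by (simp_all add: G1.P_def x y)
  with gen have good: "good_parity i j f h" by (rule generate_imp_good_parity)
  have "G2_group G (\<sigma> a\<^sub>1) (\<sigma> b\<^sub>1) \<mu> k\<^sub>1 l\<^sub>1"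
    using G1.G2_group_axioms hom is_group by (rule G2_group_hom)
  then show ?thesis
    using that[OF x y good] by (simp add: x y good_G2_group_iff[OF good])
qed

text \<open>The image is a subgroup containing a good pair, hence everything, and both groups have
  the same finite order.\<close>

lemma good_hom_iso:
  assumes hom: "\<sigma> \<in> hom G\<^sub>1 G" and x: "\<sigma> a\<^sub>1 = P i j" and y: "\<sigma> b\<^sub>1 = P f h"
    and good: "good_parity i j f h"
  shows "\<sigma> \<in> iso G\<^sub>1 G"
proof -
  interpret \<sigma>: group_hom G\<^sub>1 G \<sigma> using hom by unfold_locales
  have surj: "\<sigma> ` carrier G\<^sub>1 = carrier G"
    using good \<sigma>.img_is_subgroup by (rule good_generate) (simp_all flip: x y)
  moreover have "inj_on \<sigma> (carrier G\<^sub>1)"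
    by (rule eq_card_imp_inj_on) (simp_all add: surj card_carrier G1.card_carrier)
  ultimately show ?thesis
    using hom by (simp add: iso_def bij_betw_def)
qed

end

section \<open>Transfer to the presented groups and classification of the isomorphisms\<close>

lemma G2_relations_hold:
  assumes e: "e = d + 2" and d: "d > 0 \<or> k = 0 \<and> l = 0"
  shows "G2_group (G2 e k l) (G2_a e k l) (G2_b e k l) (2 ^ d) (int k) (int l)"
proof -
  let ?R = "G2_relations e k l"
  interpret group "presented_group ?R" by (rule group_presented_group)
  have "\<forall>(u, v) \<in> ?R. word_eval (presented_group ?R) (\<lambda>g. word_class ?R (word_gen g)) u =
      word_eval (presented_group ?R) (\<lambda>g. word_class ?R (word_gen g)) v"
    by (auto simp: word_eval_presented_group word_class_eq_iff intro: pres_eq.relation)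
  then show ?thesis
    unfolding G2_def G2_a_def G2_b_def using word_class_closed[of ?R]
    using G2_relations_iff[of "\<lambda>g. word_class ?R (word_gen g)" d k l] d
    unfolding e by blast
qed

lemma G2_hom_exists:
  assumes e: "e = d + 2" and d: "d > 0 \<or> k = 0 \<and> l = 0" and H: "G2_group H x y (2 ^ d) (int k) (int l)"
  obtains \<sigma> where "\<sigma> \<in> hom (G2 e k l) H"
    "\<sigma> (G2_a e k l) = x" "\<sigma> (G2_b e k l) = y"
proof -
  interpret G2_group H x y "2 ^ d" "int k" "int l" by fact
  define \<phi> where "\<phi> = (\<lambda>g. case g of GenA \<Rightarrow> x | GenB \<Rightarrow> y)"
  have gens: "\<phi> g \<in> carrier H" for g by (cases g) (simp_all add: \<phi>_def)
  have "\<forall>(u, v) \<in> G2_relations e k l. word_eval H \<phi> u = word_eval H \<phi> v"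
    unfolding e using d H by (subst G2_relations_iff[OF gens]) (auto simp: \<phi>_def)
  then obtain \<sigma> where "\<sigma> \<in> hom (presented_group (G2_relations e k l)) H"
    "\<And>w. \<sigma> (word_class (G2_relations e k l) w) = word_eval H \<phi> w"
    using presented_group_hom_exists[of \<phi> "G2_relations e k l"] gens by blast
  then show ?thesis
    by (intro that[of \<sigma>]) (simp_all add: G2_def G2_a_def G2_b_def word_eval_gen[OF gens], simp_all add: \<phi>_def)
qed

text \<open>Existence of normal forms is an induction on words, since \<open>P_mult\<close> keeps
  products in normal form. Uniqueness comes from the homomorphism to the model that sends generators
  to generators.\<close>

lemma G2_free_G2:
  assumes e: "e = d + 2" and d: "d > 0 \<or> k = 0 \<and> l = 0"
  shows "G2_free (G2 e k l) (G2_a e k l) (G2_b e k l) (2 ^ d) (int k) (int l) d"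
proof -
  let ?\<mu> = "2 ^ d :: int"
  let ?R = "G2_relations e k l" and ?M = "G2_model ?\<mu> (int k) (int l)"
  interpret G2_group "G2 e k l" "G2_a e k l" "G2_b e k l" ?\<mu> "int k" "int l"
    using e d by (rule G2_relations_hold)
  have par: "even ?\<mu> \<or> int k = 0 \<and> int l = 0" using d by auto
  show ?thesis
  proof unfold_locales
    show "?\<mu> = 2 ^ d" by simp
  next
    fix g assume "g \<in> carrier (G2 e k l)"
    then obtain w where g: "g = word_class ?R w" by (auto simp: G2_def presented_group_def)
    have "\<exists>i j. word_eval (G2 e k l) (\<lambda>g. word_class ?R (word_gen g)) w = P i j"
    proof (induction w)
      case Nil
      have "word_eval (G2 e k l) (\<lambda>g. word_class ?R (word_gen g)) [] = P 0 0"
        by (simp add: word_eval_def P_0)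
      then show ?case by blast
    next
      case (Cons p w)
      obtain x s where p: "p = (x, s)" by (cases p)
      obtain i j where ij: "word_eval (G2 e k l) (\<lambda>g. word_class ?R (word_gen g)) w = P i j"
        using Cons by blast
      have "\<exists>u v. (if s then word_class ?R (word_gen x) else inv\<^bsub>G2 e k l\<^esub> word_class ?R (word_gen x)) = P u v"
      proof (cases x)
        case GenA
        have "(if s then G2_a e k l else inv\<^bsub>G2 e k l\<^esub> G2_a e k l) = P (if s then 1 else -1) 0"
          by (simp add: P_def int_pow_neg)
        then show ?thesis unfolding GenA G2_a_def by blast
      next
        case GenB
        have "(if s then G2_b e k l else inv\<^bsub>G2 e k l\<^esub> G2_b e k l) = P 0 (if s then 1 else -1)"
          by (simp add: P_def int_pow_neg)
        then show ?thesis unfolding GenB G2_b_def by blast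
      qed
      then obtain u v where uv: "(if s then word_class ?R (word_gen x) else inv\<^bsub>G2 e k l\<^esub> word_class ?R (word_gen x)) = P u v"
        by blast
      have "word_eval (G2 e k l) (\<lambda>g. word_class ?R (word_gen g)) (p # w) = P u v \<otimes>\<^bsub>G2 e k l\<^esub> P i j"
        unfolding uv[symmetric] ij[symmetric] p by (simp add: word_eval_def)
      then show ?case unfolding P_mult by blast
    qed
    then show "\<exists>i j. g = P i j"
      unfolding g by (simp add: word_eval_presented_group G2_def)
  next
    fix i j i' j' assume eq: "P i j = P i' j'"
    have M: "group ?M" by (rule group_G2_model) (use par in simp_all)
    obtain \<tau> where \<tau>: "\<tau> \<in> hom (G2 e k l) ?M"
      "\<tau> (G2_a e k l) = reduce (4 * ?\<mu>) (1, 0)" "\<tau> (G2_b e k l) = reduce (4 * ?\<mu>) (0, 1)"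
      using G2_hom_exists[OF e d G2_group_model(1)[OF _ par]] by auto
    interpret M: group ?M by fact
    interpret \<tau>: group_hom "G2 e k l" ?M \<tau> using \<tau>(1) by unfold_locales
    have "\<tau> (P u v) = reduce (4 * ?\<mu>) (u, v)" for u v
      using G2_group_model(2)[of ?\<mu> "int k" "int l" u v] par
      by (simp add: P_def \<tau>.hom_int_pow \<tau>(2,3))
    with eq have "reduce (4 * ?\<mu>) (i, j) = reduce (4 * ?\<mu>) (i', j')" by metis
    then show "[i = i'] (mod (4 * ?\<mu>)) \<and> [j = j'] (mod (4 * ?\<mu>))"
      by (simp add: reduce_eq_iff cong_pair_def)
  qed
qed

theorem lemma2p2:
  fixes e n k l k1 l1 :: nat
  assumes "n = 2 ^ e" and "n \<ge> 4"
    and "k \<in> {0, 1}" and "l \<in> {0, 1}" and "k1 \<in> {0, 1}" and "l1 \<in> {0, 1}"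
    and "e = 2 \<Longrightarrow> k = 0 \<and> l = 0 \<and> k1 = 0 \<and> l1 = 0"
  shows "(\<forall>\<sigma> \<in> iso (G2 e k1 l1) (G2 e k l).
            \<exists>i j f h :: int. iso_params k1 l1 k l i j f h \<and>
              gens_mapped_to e k1 l1 k l \<sigma> i j f h) \<and>
         (\<forall>i j f h :: int. iso_params k1 l1 k l i j f h \<longrightarrow>
            (\<exists>!\<sigma>. \<sigma> \<in> iso (G2 e k1 l1) (G2 e k l) \<and>
              \<sigma> \<in> extensional (carrier (G2 e k1 l1)) \<and>
              gens_mapped_to e k1 l1 k l \<sigma> i j f h))"
proof -
  have "e \<ge> 2"
  proof (rule ccontr)
    assume "\<not> e \<ge> 2"
    then have "e = 0 \<or> e = 1" by auto
    with assms(1,2) show False by auto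
  qed
  \<comment> \<open>Here n = 4 * 2^d, and d = 0 is the case n = 4, in which all parameters
    vanish.\<close>
  then obtain d where e: "e = d + 2" by (metis add.commute le_iff_add)
  have d: "d > 0 \<or> k = 0 \<and> l = 0" and d1: "d > 0 \<or> k1 = 0 \<and> l1 = 0"
    using assms(7) by (auto simp: e)
  interpret A: G2_free "G2 e k l" "G2_a e k l" "G2_b e k l" "2 ^ d" "int k" "int l" d
    using e d by (rule G2_free_G2)
  interpret B: G2_free "G2 e k1 l1" "G2_a e k1 l1" "G2_b e k1 l1" "2 ^ d" "int k1" "int l1" d
    using e d1 by (rule G2_free_G2)
  interpret G2_free_pair "G2 e k l" "G2_a e k l" "G2_b e k l" "2 ^ d" "int k" "int l" d
    "G2 e k1 l1" "G2_a e k1 l1" "G2_b e k1 l1" "int k1" "int l1" ..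
  \<comment> \<open>Since l and l1 lie in {0, 1}, their equality is the same as equality of
    parities.\<close>
  have params: "iso_params k1 l1 k l i j f h \<longleftrightarrow> good_parity i j f h \<and> even (int l1 - int l) \<and>
      even (int k1 - (int k + int l * (f + h - i - j) div 2))" for i j f h
    using assms(4,6) by (auto simp: iso_params_def good_parity_def cong_iff_dvd_diff)
  have mapped: "gens_mapped_to e k1 l1 k l \<sigma> i j f h \<longleftrightarrow>
      \<sigma> (G2_a e k1 l1) = A.P i j \<and> \<sigma> (G2_b e k1 l1) = A.P f h" for \<sigma> i j f h
    by (simp add: gens_mapped_to_def A.P_def)
  show ?thesis
  proof (intro conjI ballI allI impI)
    fix \<sigma> assume "\<sigma> \<in> iso (G2 e k1 l1) (G2 e k l)"
    then show "\<exists>i j f h. iso_params k1 l1 k l i j f h \<and> gens_mapped_to e k1 l1 k l \<sigma> i j f h"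
      unfolding params mapped using iso_imp_params by metis
  next
    fix i j f h assume ijfh: "iso_params k1 l1 k l i j f h"
    then have good: "good_parity i j f h" by (simp add: params)
    have "G2_group (G2 e k l) (A.P i j) (A.P f h) (2 ^ d) (int k1) (int l1)"
      using ijfh B.parity by (simp add: A.good_G2_group_iff[OF good] params)
    then obtain \<sigma> where \<sigma>: "\<sigma> \<in> hom (G2 e k1 l1) (G2 e k l)"
      "\<sigma> (G2_a e k1 l1) = A.P i j" "\<sigma> (G2_b e k1 l1) = A.P f h"
      using G2_hom_exists[OF e d1] by metis
    \<comment> \<open>A homomorphism is arbitrary outside the carrier; restricting it fixes these
      values, so that uniqueness can hold for the HOL function itself.\<close>
    let ?\<sigma> = "restrict \<sigma> (carrier (G2 e k1 l1))"
    have r: "?\<sigma> \<in> hom (G2 e k1 l1) (G2 e k l)" "?\<sigma> (G2_a e k1 l1) = A.P i j" "?\<sigma> (G2_b e k1 l1) = A.P f h"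
      using \<sigma> by (auto intro: B.hom_restrict[OF \<sigma>(1)])
    show "\<exists>!\<sigma>. \<sigma> \<in> iso (G2 e k1 l1) (G2 e k l) \<and> \<sigma> \<in> extensional (carrier (G2 e k1 l1)) \<and>
        gens_mapped_to e k1 l1 k l \<sigma> i j f h"
      unfolding mapped
    proof (intro ex1I[of _ ?\<sigma>] conjI)
      show "?\<sigma> \<in> iso (G2 e k1 l1) (G2 e k l)" using r good by (rule good_hom_iso)
    next
      fix \<tau> assume \<tau>: "\<tau> \<in> iso (G2 e k1 l1) (G2 e k l) \<and> \<tau> \<in> extensional (carrier (G2 e k1 l1)) \<and>
        \<tau> (G2_a e k1 l1) = A.P i j \<and> \<tau> (G2_b e k1 l1) = A.P f h"
      then have hom: "\<tau> \<in> hom (G2 e k1 l1) (G2 e k l)" by (simp add: iso_def)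
      have "\<tau> g = ?\<sigma> g" if "g \<in> carrier (G2 e k1 l1)" for g
        by (rule B.hom_determined[OF A.is_group hom r(1) _ _ that]) (simp_all only: \<tau> r(2,3))
      with \<tau> show "\<tau> = ?\<sigma>" by (blast intro: extensionalityI restrict_extensional)
    qed (use r in simp_all)
  qed
qed

end
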